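(* Let $k,\ell\in\mathbb{N}$ with $k<\ell$ and let $f\in\mathcal{H}$ satisfy $f(t)\ll t^k$ (with a representative defined and smooth on $[1,\infty)$). For $N\in\mathbb{N}$ let $P_{N,\ell}(y) = \sum_{j=0}^{\ell-1}\frac{y^j}{j!}f^{(j)}(N)$ be the length-$\ell$ Taylor polynomial of $f$ at $N$. Then there exists $0<\eta<1$ depending only on $\ell$ such that for every $H\in\mathbb{N}$, the formula \[ e_N(h) := \lfloor f(N+h)\rfloor - \lfloor P_{N,\ell}(h)\rfloor,\qquad 0\le h<H, \] defines at most $\exp(O(H^{\eta}))$ different functions $e_N\colon\{0,1,\dots,H-1\}\to\mathbb{Z}$ as $N$ ranges over $\mathbb{N}$. Moreover, for each $N$ at least one of the following holds: (A) $N = O(H^{(\ell+\eta)/(\ell-k)})$; (B) there are at most $O(H^{\eta})$ values of $h\in\{0,\dots,H-1\}$ with $e_N(h)\neq 0$; (C) there exists a partition of $\{0,\dots,H-1\}$ into $O(H^{\eta})$ arithmetic progressions with step $O(H^{\eta})$ on each of which $e_N$ is constant. Here all implicit constants in $O(\cdot)$ depend only on $k,\ell$ and $f$ (not on $H$ or $N$).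
   Context: $\mathcal{H}$ denotes the union of all Hardy fields (subfields of the ring of germs at $+\infty$ of real functions on half-lines, closed under differentiation). $f(t)\ll t^k$ means $|f(t)|\le Ct^k$ for some $C>0$ and all large $t$. *)

theory Defs
  imports "HOL-Analysis.Analysis" "HOL-Library.Disjoint_Sets"
begin

text \<open>Hardy fields. A germ at +infinity is represented by any function real => real;
  two functions represent the same germ iff they agree eventually (at_top).
  A Hardy field is a set F of (representatives of) germs that is a subfield of the
  ring of germs (containing 0 and 1, closed under +, -, *, and inverses of nonzero germs)
  and is closed under differentiation (each element is eventually differentiable and
  its derivative germ lies in F).\<close>

definition hardy_field :: "(real \<Rightarrow> real) set \<Rightarrow> bool" where
  "hardy_field F \<longleftrightarrow>
     (\<lambda>_. 0) \<in> F \<and> (\<lambda>_. 1) \<in> F \<and>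
     (\<forall>f\<in>F. \<forall>g\<in>F. (\<lambda>t. f t + g t) \<in> F \<and> (\<lambda>t. f t * g t) \<in> F) \<and>
     (\<forall>f\<in>F. (\<lambda>t. - f t) \<in> F) \<and>
     (\<forall>f\<in>F. \<not> (\<forall>\<^sub>F t in at_top. f t = 0) \<longrightarrow>
        (\<exists>g\<in>F. \<forall>\<^sub>F t in at_top. f t * g t = 1)) \<and>
     (\<forall>f\<in>F. \<exists>g\<in>F. \<forall>\<^sub>F t in at_top. (f has_real_derivative g t) (at t))"

definition in_hardy :: "(real \<Rightarrow> real) \<Rightarrow> bool" where
  "in_hardy f \<longleftrightarrow> (\<exists>F. hardy_field F \<and> (\<exists>g\<in>F. \<forall>\<^sub>F t in at_top. f t = g t))"

definition arith_prog :: "nat set \<Rightarrow> nat \<Rightarrow> bool" where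
  "arith_prog S d \<longleftrightarrow> d \<ge> 1 \<and> (\<exists>a m. m \<ge> 1 \<and> S = (\<lambda>i. a + d * i) ` {..<m})"

text \<open>Length-l Taylor polynomial at N, given the derivative family D (D j = f^(j)).\<close>
definition taylor_poly :: "(nat \<Rightarrow> real \<Rightarrow> real) \<Rightarrow> nat \<Rightarrow> nat \<Rightarrow> real \<Rightarrow> real" where
  "taylor_poly D l N y = (\<Sum>j<l. y ^ j / fact j * D j (real N))"

definition err :: "(real \<Rightarrow> real) \<Rightarrow> (nat \<Rightarrow> real \<Rightarrow> real) \<Rightarrow> nat \<Rightarrow> nat \<Rightarrow> nat \<Rightarrow> int" where
  "err f D l N h = \<lfloor>f (real N + real h)\<rfloor> - \<lfloor>taylor_poly D l N (real h)\<rfloor>"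

end

theory Submission
  imports Defs
begin

text \<open>
  Eventual monotonicity of the derivatives gives \<open>D l t = O(t powr (k - l))\<close>, so if (A) fails the
  Taylor polynomial \<open>P\<close> approximates \<open>f(N + h)\<close> up to \<open>\<epsilon> = c H powr (-\<eta>)\<close>, and \<open>e\<^sub>N(h) \<noteq> 0\<close> forces \<open>P(h)\<close>
  to lie within \<open>\<epsilon>\<close> of an integer. If there are more than \<open>O(H powr \<eta>)\<close> such hits, then \<open>l\<close> of them lie
  close together; interpolation through them yields \<open>q = O(H powr (1/2))\<close> and an integer polynomial \<open>Z\<close>
  with \<open>q P - Z\<close> tiny near these hits. Since the hits are dense and \<open>q * \<epsilon>\<close> is at most a negative power of \<open>H\<close>, this spreads by
  doubling the window to all of \<open>[0, H]\<close>. On a residue class mod \<open>q\<close> the polynomial \<open>Z/q\<close> is constant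
  modulo \<open>1\<close>, and \<open>e\<^sub>N\<close> is then determined by the signs of \<open>P - Z/q\<close> and \<open>f - Z/q\<close>, each of which
  changes boundedly often. The first alternative contributes polynomially many functions, and a
  function as in (B) or (C) is encoded by \<open>O(H powr \<eta>)\<close> arithmetic progressions.
\<close>

section \<open>Interpolation\<close>

text \<open>The Lagrange sum is itself a polynomial of degree below \<open>card X\<close> that
  agrees with \<open>p\<close> on \<open>X\<close>, and two such polynomials coincide.\<close>

lemma lagrange_interpolation:
  fixes p :: "'a::field poly"
  assumes "finite X" and "degree p < card X"
  shows "poly p y = (\<Sum>x\<in>X. poly p x * (\<Prod>z\<in>X - {x}. (y - z) / (x - z)))"
proof -
  define q where
    "q = (\<Sum>x\<in>X. smult (poly p x / (\<Prod>z\<in>X - {x}. x - z)) (\<Prod>z\<in>X - {x}. [:- z, 1:]))"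
  have eval: "poly q y = (\<Sum>x\<in>X. poly p x * (\<Prod>z\<in>X - {x}. (y - z) / (x - z)))" for y
    by (simp add: q_def poly_sum poly_prod prod_dividef)
  have "p = q"
  proof (rule poly_eqI_degree[of X])
    fix x assume x: "x \<in> X"
    have "poly q x = (\<Sum>x'\<in>X. if x' = x then poly p x else 0)"
      unfolding eval
    proof (rule sum.cong)
      fix x' assume x': "x' \<in> X"
      show "poly p x' * (\<Prod>z\<in>X - {x'}. (x - z) / (x' - z)) = (if x' = x then poly p x else 0)"
      proof (cases "x' = x")
        case True
        have "(\<Prod>z\<in>X - {x}. (x - z) / (x - z)) = 1"
          by (rule prod.neutral) auto
        then show ?thesis using True by simp
      next
        case False
        then have "(\<Prod>z\<in>X - {x'}. (x - z) / (x' - z)) = 0"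
          using x assms(1) by (intro prod_zero) auto
        then show ?thesis using False by simp
      qed
    qed simp
    then show "poly p x = poly q x" using x assms(1) by simp
  next
    show "degree q < card X"
      unfolding q_def
    proof (rule degree_sum_less)
      fix x assume x: "x \<in> X"
      have "degree (\<Prod>z\<in>X - {x}. [:- z, 1:]) = card X - 1"
        using x assms(1) by (subst degree_prod_sum_eq) auto
      then show "degree (smult (poly p x / (\<Prod>z\<in>X - {x}. x - z)) (\<Prod>z\<in>X - {x}. [:- z, 1:])) < card X"
        using assms(2) degree_smult_le[of "poly p x / (\<Prod>z\<in>X - {x}. x - z)" "\<Prod>z\<in>X - {x}. [:- z, 1:]"]
        by linarith
    qed (use assms(2) in simp)
  qed fact
  show ?thesis unfolding eval[symmetric] by (simp only: \<open>p = q\<close>[symmetric])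
qed

text \<open>Each factor of a Lagrange basis polynomial is at most \<open>w / g\<close>. Only this
  ratio enters, so the estimate is equally strong at every scale.\<close>

lemma poly_bound_of_spaced_points:
  fixes p :: "real poly"
  assumes X: "finite X" "degree p < card X"
    and s: "\<And>x. x \<in> X \<Longrightarrow> \<bar>poly p x\<bar> \<le> s"
    and gap: "\<And>x z. x \<in> X \<Longrightarrow> z \<in> X \<Longrightarrow> x \<noteq> z \<Longrightarrow> g \<le> \<bar>x - z\<bar>" and "g > 0"
    and w: "\<And>x. x \<in> X \<Longrightarrow> \<bar>y - x\<bar> \<le> w"
  shows "\<bar>poly p y\<bar> \<le> card X * (w / g) ^ (card X - 1) * s"
proof -
  have "\<bar>poly p y\<bar> \<le> (\<Sum>x\<in>X. \<bar>poly p x * (\<Prod>z\<in>X - {x}. (y - z) / (x - z))\<bar>)"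
    by (subst lagrange_interpolation[OF X]) (rule sum_abs)
  also have "\<dots> \<le> (\<Sum>x\<in>X. s * (w / g) ^ (card X - 1))"
  proof (rule sum_mono)
    fix x assume x: "x \<in> X"
    have "\<bar>\<Prod>z\<in>X - {x}. (y - z) / (x - z)\<bar> = (\<Prod>z\<in>X - {x}. \<bar>y - z\<bar> / \<bar>x - z\<bar>)"
      by (simp add: abs_prod)
    also have "\<dots> \<le> (\<Prod>z\<in>X - {x}. w / g)"
    proof (rule prod_mono, intro conjI)
      fix z assume z: "z \<in> X - {x}"
      show "\<bar>y - z\<bar> / \<bar>x - z\<bar> \<le> w / g"
        using gap[of x z] w[of z] z x \<open>g > 0\<close> by (intro frac_le) auto
    qed simp
    also have "\<dots> = (w / g) ^ (card X - 1)"
      using x X(1) by simp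
    finally have "\<bar>\<Prod>z\<in>X - {x}. (y - z) / (x - z)\<bar> \<le> (w / g) ^ (card X - 1)" .
    then show "\<bar>poly p x * (\<Prod>z\<in>X - {x}. (y - z) / (x - z))\<bar> \<le> s * (w / g) ^ (card X - 1)"
      using s[OF x] unfolding abs_mult by (intro mult_mono) auto
  qed
  also have "\<dots> = card X * (w / g) ^ (card X - 1) * s"
    by simp
  finally show ?thesis .
qed

text \<open>The denominators in Lagrange's formula are the \<open>v x\<close>; the product
  \<open>q\<close> of their absolute values clears them all at once. It is built from
  \<open>card X * (card X - 1)\<close> differences, each at most \<open>W\<close>, so its size is
  independent of the values \<open>m\<close>.\<close>

lemma integer_interpolation:
  fixes X :: "int set" and m :: "int \<Rightarrow> int" and W :: real
  assumes X: "finite X" "X \<noteq> {}"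
    and W: "\<And>x z. x \<in> X \<Longrightarrow> z \<in> X \<Longrightarrow> \<bar>x - z\<bar> \<le> W"
  shows "\<exists>(q::int) Z. 1 \<le> q \<and> q \<le> W ^ (card X * (card X - 1)) \<and> degree Z < card X \<and>
           (\<forall>x\<in>X. poly Z x = q * m x)"
proof -
  define v where "v x = (\<Prod>z\<in>X - {x}. x - z)" for x
  define q where "q = (\<Prod>x\<in>X. \<bar>v x\<bar>)"
  define Z where "Z = (\<Sum>x\<in>X. smult (m x * (q div v x)) (\<Prod>z\<in>X - {x}. [:- z, 1:]))"
  have v0: "v x \<noteq> 0" for x
    using X(1) by (auto simp: v_def)
  have vq: "v x dvd q" if "x \<in> X" for x
    using dvd_prodI[OF X(1) that, of "\<lambda>x. \<bar>v x\<bar>"] by (simp add: q_def)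
  have "q > 0"
    using v0 by (auto simp: q_def intro!: prod_pos)
  have "real_of_int q \<le> (\<Prod>x\<in>X. W ^ (card X - 1))"
    unfolding q_def of_int_prod
  proof (intro prod_mono conjI)
    fix x assume x: "x \<in> X"
    have "real_of_int \<bar>v x\<bar> = (\<Prod>z\<in>X - {x}. real_of_int \<bar>x - z\<bar>)"
      by (simp add: v_def abs_prod)
    also have "\<dots> \<le> (\<Prod>z\<in>X - {x}. W)"
      using W x by (intro prod_mono) auto
    also have "\<dots> = W ^ (card X - 1)"
      using X x by simp
    finally show "real_of_int \<bar>v x\<bar> \<le> W ^ (card X - 1)" .
  qed simp
  also have "\<dots> = W ^ (card X * (card X - 1))"
    by (simp add: power_mult[symmetric] mult.commute)
  finally have qW: "q \<le> W ^ (card X * (card X - 1))" .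
  have deg: "degree Z < card X"
    unfolding Z_def
  proof (rule degree_sum_less)
    fix x assume x: "x \<in> X"
    have "degree (\<Prod>z\<in>X - {x}. [:- z, 1:]) = card X - 1"
      using x X(1) by (subst degree_prod_sum_eq) auto
    moreover have "card X > 0"
      using X by (simp add: card_gt_0_iff)
    ultimately show "degree (smult (m x * (q div v x)) (\<Prod>z\<in>X - {x}. [:- z, 1:])) < card X"
      using degree_smult_le[of "m x * (q div v x)" "\<Prod>z\<in>X - {x}. [:- z, 1:]"] by linarith
  qed (use X in \<open>simp add: card_gt_0_iff\<close>)
  have "poly Z x = q * m x" if x: "x \<in> X" for x
  proof -
    have "poly Z x = (\<Sum>x'\<in>X. if x' = x then q * m x else 0)"
      unfolding Z_def poly_sum
    proof (rule sum.cong)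
      fix x' assume x': "x' \<in> X"
      show "poly (smult (m x' * (q div v x')) (\<Prod>z\<in>X - {x'}. [:- z, 1:])) x
          = (if x' = x then q * m x else 0)"
      proof (cases "x' = x")
        case True
        have "poly (\<Prod>z\<in>X - {x}. [:- z, 1:]) x = v x"
          by (simp add: poly_prod v_def)
        then show ?thesis using True vq[OF x] by simp
      next
        case False
        have "poly (\<Prod>z\<in>X - {x'}. [:- z, 1:]) x = 0"
          using x X(1) False by (auto simp: poly_prod)
        then show ?thesis using False by simp
      qed
    qed simp
    then show ?thesis using x X(1) by simp
  qed
  with \<open>q > 0\<close> qW deg show ?thesis by (intro exI[of _ q] exI[of _ Z]) auto
qed

section \<open>Well-spaced subsets of dense sets of integers\<close>

lemma sorted_int_nth_gap:
  fixes xs :: "int list"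
  assumes "sorted_wrt (<) xs" "i \<le> j" "j < length xs"
  shows "int (j - i) \<le> xs ! j - xs ! i"
  using assms(2,3)
proof (induction j rule: dec_induct)
  case base
  then show ?case by simp
next
  case (step j)
  have "xs ! j < xs ! Suc j"
    using assms(1) step by (simp add: sorted_wrt_nth_less)
  with step show ?case by (simp add: Suc_diff_le)
qed

text \<open>Every \<open>g\<close>-th entry of the increasing enumeration of \<open>E\<close> is
  taken, where \<open>g = card E div l\<close>; distinct integers \<open>g\<close> places apart
  differ by at least \<open>g\<close>.\<close>

lemma exists_spaced_subset:
  fixes E :: "int set"
  assumes "finite E" "0 < l" "l \<le> card E"
  shows "\<exists>X\<subseteq>E. card X = l \<and>
    (\<forall>x\<in>X. \<forall>z\<in>X. x \<noteq> z \<longrightarrow> int (card E div l) \<le> \<bar>x - z\<bar>)"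
proof -
  define g where "g = card E div l"
  define xs where "xs = sorted_list_of_set E"
  have sorted: "sorted_wrt (<) xs" and set: "set xs = E" and len: "length xs = card E"
    using assms(1) by (simp_all add: xs_def)
  have "g \<ge> 1"
    using assms by (simp add: g_def div_greater_zero_iff Suc_leI)
  have idx: "i * g < length xs" if "i < l" for i
  proof -
    have "i * g < l * g" using that \<open>g \<ge> 1\<close> by simp
    also have "\<dots> \<le> card E" by (simp add: g_def)
    finally show ?thesis by (simp add: len)
  qed
  define x where "x i = xs ! (i * g)" for i
  have gap: "int g \<le> x j - x i" if "i < j" "j < l" for i j
  proof -
    have "1 \<le> j - i" using that by linarith
    from mult_le_mono1[OF this, of g] have "g \<le> (j - i) * g" by simp
    also have "\<dots> = j * g - i * g" by (simp add: diff_mult_distrib)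
    finally have "int g \<le> int (j * g - i * g)" by linarith
    also have "\<dots> \<le> x j - x i"
      unfolding x_def using that idx by (intro sorted_int_nth_gap[OF sorted]) auto
    finally show ?thesis .
  qed
  have gap': "int g \<le> \<bar>x i - x j\<bar>" if "i \<noteq> j" "i < l" "j < l" for i j
    using gap[of i j] gap[of j i] that by (cases "i < j") auto
  have "inj_on x {..<l}"
  proof (rule inj_onI, rule ccontr)
    fix i j assume "i \<in> {..<l}" "j \<in> {..<l}" "x i = x j" "i \<noteq> j"
    then show False using gap'[of i j] \<open>g \<ge> 1\<close> by simp
  qed
  then have "card (x ` {..<l}) = l"
    by (simp add: card_image)
  moreover have "x ` {..<l} \<subseteq> E"
    using idx set by (auto simp: x_def intro!: nth_mem)
  moreover have "int g \<le> \<bar>a - b\<bar>" if ab: "a \<in> x ` {..<l}" "b \<in> x ` {..<l}" "a \<noteq> b" for a b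
  proof -
    obtain i j where "a = x i" "b = x j" "i < l" "j < l"
      using ab by blast
    then show ?thesis using gap'[of i j] ab(3) by auto
  qed
  ultimately show ?thesis
    unfolding g_def[symmetric] by (intro exI[of _ "x ` {..<l}"]) simp
qed

text \<open>The numerical hypothesis expresses density at least \<open>l / L\<close> in a window of
  length \<open>t\<close>. It forces \<open>card E div l\<close> to be at least 1, so rounding down
  costs at most a factor 2, and the ratio of window to spacing, which is all that interpolation
  sees, is at most \<open>2 * L\<close>.\<close>

lemma dense_set_has_spaced_subset:
  fixes E :: "int set" and L t :: real
  assumes "finite E" "0 < l" "1 \<le> L" "L \<le> t" "l * t \<le> L * card E"
  shows "\<exists>X g. X \<subseteq> E \<and> card X = l \<and> 0 < g \<and> t \<le> 2 * L * g \<and>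
    (\<forall>x\<in>X. \<forall>z\<in>X. x \<noteq> z \<longrightarrow> g \<le> \<bar>real_of_int x - real_of_int z\<bar>)"
proof -
  define g where "g = card E div l"
  have "l * L \<le> l * t"
    using assms(4) by (rule mult_left_mono) simp
  then have "l * L \<le> L * card E"
    using assms(5) by linarith
  then have card: "l \<le> card E"
    using assms(3) by (simp add: mult.commute)
  have "1 \<le> g"
    using card assms(2) by (simp add: g_def div_greater_zero_iff Suc_leI)
  then have "l \<le> l * g" by simp
  have "card E < l * g + l"
    unfolding g_def using mult_div_mod_eq[of l "card E"] mod_less_divisor[OF assms(2), of "card E"]
    by linarith
  also have "\<dots> \<le> 2 * (l * g)"
    using \<open>l \<le> l * g\<close> by simp
  finally have "real (card E) \<le> 2 * (real l * real g)"
    by (metis less_imp_le of_nat_le_iff of_nat_mult of_nat_numeral)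
  then have "L * card E \<le> L * (2 * (real l * real g))"
    using assms(3) by (intro mult_left_mono) auto
  then have "l * t \<le> l * (2 * L * g)"
    using assms(5) by (simp add: algebra_simps)
  then have "t \<le> 2 * L * g"
    using assms(2) by simp
  moreover obtain X where X: "X \<subseteq> E" "card X = l"
    and gap: "\<forall>x\<in>X. \<forall>z\<in>X. x \<noteq> z \<longrightarrow> int g \<le> \<bar>x - z\<bar>"
    using exists_spaced_subset[OF assms(1,2) card] unfolding g_def by auto
  moreover have "real g \<le> \<bar>real_of_int x - real_of_int z\<bar>" if "x \<in> X" "z \<in> X" "x \<noteq> z" for x z
    using gap that by (metis of_int_abs of_int_diff of_int_le_iff of_int_of_nat_eq)
  ultimately show ?thesis
    using \<open>1 \<le> g\<close> by (intro exI[of _ X] exI[of _ "real g"]) auto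
qed

section \<open>Polynomials close to integers on a dense set\<close>

lemma degree_map_poly_of_int_le: "degree (map_poly of_int Z :: 'a::ring_1 poly) \<le> degree Z"
  by (rule degree_le) (simp add: coeff_map_poly coeff_eq_0)

lemma poly_map_poly_of_int: "poly (map_poly of_int Z) (of_int x) = (of_int (poly Z x) :: 'a::comm_ring_1)"
  by (induction Z) (simp_all add: map_poly_pCons)

text \<open>The Lagrange bound is applied to \<open>q * P - Z\<close>, which at a point of
  \<open>X\<close> equals \<open>q * (P x - m x)\<close> and hence is at most
  \<open>q * \<epsilon>\<close> in absolute value.\<close>

lemma curve_bound_of_spaced_hits:
  fixes P :: "real poly" and Z :: "int poly" and m :: "int \<Rightarrow> int" and X :: "int set"
    and q :: int and L \<epsilon> g w y :: real
  assumes X: "finite X" "card X = l" and deg: "degree P < l" "degree Z < l"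
    and hit: "\<And>x. x \<in> X \<Longrightarrow> \<bar>poly P x - m x\<bar> \<le> \<epsilon>"
    and curve: "\<And>x. x \<in> X \<Longrightarrow> poly Z x = q * m x" and "q \<ge> 1"
    and gap: "\<And>x z. x \<in> X \<Longrightarrow> z \<in> X \<Longrightarrow> x \<noteq> z \<Longrightarrow> g \<le> \<bar>real_of_int x - z\<bar>" and "g > 0"
    and w: "\<And>x. x \<in> X \<Longrightarrow> \<bar>y - x\<bar> \<le> w" "w \<le> 6 * L * g"
  shows "\<bar>q * poly P y - poly (map_poly of_int Z) y\<bar> \<le> l * (6 * L) ^ (l - 1) * (q * \<epsilon>)"
proof -
  define S where "S = smult (of_int q) P - map_poly of_int Z"
  define X' where "X' = real_of_int ` X"
  have card: "card X' = l" and fin: "finite X'"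
    using X by (auto simp: X'_def card_image inj_on_def)
  have "degree (map_poly of_int Z :: real poly) \<le> degree Z"
    by (rule degree_map_poly_of_int_le)
  then have "degree S < card X'"
    unfolding S_def card using deg
    by (intro degree_diff_less) (auto intro: le_less_trans[OF degree_smult_le])
  have bd: "\<bar>poly S x\<bar> \<le> q * \<epsilon>" if x': "x \<in> X'" for x
  proof -
    obtain z where z: "x = of_int z" "z \<in> X"
      using x' by (auto simp: X'_def)
    have "poly (map_poly of_int Z) x = (of_int (q * m z) :: real)"
      using curve[OF z(2)] z by (metis poly_map_poly_of_int)
    then have "poly S x = q * (poly P z - m z)"
      by (simp add: S_def z algebra_simps)
    then have "\<bar>poly S x\<bar> = q * \<bar>poly P z - m z\<bar>"
      using \<open>q \<ge> 1\<close> by (simp add: abs_mult)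
    then show ?thesis
      using hit[OF z(2)] \<open>q \<ge> 1\<close> by simp
  qed
  obtain x0 where x0: "x0 \<in> X"
    using X deg by fastforce
  have "0 \<le> w" using w(1)[OF x0] by linarith
  have "0 \<le> \<epsilon>" using hit[OF x0] by linarith
  have "\<bar>poly S y\<bar> \<le> card X' * (w / g) ^ (card X' - 1) * (q * \<epsilon>)"
    using gap w(1) bd \<open>g > 0\<close> \<open>degree S < card X'\<close> fin
    by (intro poly_bound_of_spaced_points[of X' S "q * \<epsilon>" g y w]) (auto simp: X'_def)
  also have "\<dots> \<le> l * (6 * L) ^ (l - 1) * (q * \<epsilon>)"
    unfolding card using \<open>0 \<le> \<epsilon>\<close> \<open>q \<ge> 1\<close> \<open>g > 0\<close> w(2) \<open>0 \<le> w\<close>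
    by (intro mult_right_mono mult_left_mono power_mono) (auto simp: divide_le_eq)
  finally show ?thesis
    by (simp add: S_def)
qed

text \<open>Invariant: all lattice points \<open>(x, m x)\<close> with \<open>x \<in> E\<close> in the window lie on the rational curve
  \<open>q * y = Z x\<close>. The density of \<open>E\<close> survives in one half of every window, so one halves down to
  windows of length about \<open>L\<close>, where \<open>l\<close> points are interpolated exactly; going back up, \<open>q * P - Z\<close>
  is tiny on well-spaced hits of the half, hence less than \<open>1/2\<close> on the whole window, and it is
  near an integer at each hit.\<close>

lemma hits_on_rational_curve:
  fixes P :: "real poly" and m :: "int \<Rightarrow> int" and E :: "int set" and L \<epsilon> :: real
  assumes deg: "degree P < l" and "L \<ge> 1"
    and hit: "\<And>x. x \<in> E \<Longrightarrow> \<bar>poly P x - m x\<bar> \<le> \<epsilon>"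
    and small: "l * (6 * L) ^ (l - 1) * ((4 * L) ^ (l * (l - 1)) * \<epsilon>) < 1 / 2"
  shows "L \<le> real n \<Longrightarrow> l * real n \<le> L * card (E \<inter> {a..<a + int n}) \<Longrightarrow>
    \<exists>(q::int) Z. 1 \<le> q \<and> q \<le> (4 * L) ^ (l * (l - 1)) \<and> degree Z < l \<and>
      (\<forall>x\<in>E \<inter> {a..<a + int n}. poly Z x = q * m x)"
proof (induction n arbitrary: a rule: less_induct)
  case (less n)
  let ?Q = "(4 * L) ^ (l * (l - 1))"
  let ?K = "l * (6 * L) ^ (l - 1)"
  have "l > 0" using deg by simp
  have K: "1 \<le> ?K"
    using \<open>l > 0\<close> \<open>L \<ge> 1\<close> mult_mono[of 1 "real l" 1 "(6 * L) ^ (l - 1)"] one_le_power[of "6 * L" "l - 1"]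
    by simp
  \<comment> \<open>At a hit, the integers \<open>q * m x\<close> and \<open>Z x\<close> both lie
    near \<open>q * P x\<close>, at distances summing to less than 1, so they are equal. Both cases
    below end this way.\<close>
  have extend: "poly Z x = q * m x"
    if X: "finite X" "card X = l" "X \<subseteq> E" and Z: "degree Z < l" "\<And>x. x \<in> X \<Longrightarrow> poly Z x = q * m x"
      and q: "1 \<le> q" "q \<le> ?Q"
      and gap: "\<And>x z. x \<in> X \<Longrightarrow> z \<in> X \<Longrightarrow> x \<noteq> z \<Longrightarrow> g \<le> \<bar>real_of_int x - z\<bar>" "g > 0"
      and w: "\<And>x. x \<in> X \<Longrightarrow> \<bar>y - real_of_int x\<bar> \<le> w" "w \<le> 6 * L * g"
      and x: "x \<in> E" "y = of_int x"
    for X Z q g y w x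
  proof -
    have "0 \<le> \<epsilon>" using hit[OF x(1)] by linarith
    have "?K * (q * \<epsilon>) \<le> ?K * (?Q * \<epsilon>)"
      using q(2) \<open>0 \<le> \<epsilon>\<close> K by (intro mult_left_mono mult_right_mono) auto
    with small have 1: "?K * (q * \<epsilon>) < 1 / 2" by linarith
    moreover have "0 \<le> q * \<epsilon>" using \<open>0 \<le> \<epsilon>\<close> q by simp
    then have "q * \<epsilon> \<le> ?K * (q * \<epsilon>)"
      using mult_right_mono[OF K] by fastforce
    moreover have "\<bar>q * (m x - poly P x)\<bar> \<le> q * \<epsilon>"
      using hit[OF x(1)] q by (simp add: abs_mult abs_minus_commute)
    moreover have "\<bar>q * poly P y - poly (map_poly of_int Z) y\<bar> \<le> ?K * (q * \<epsilon>)"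
      using X Z q gap w hit deg by (intro curve_bound_of_spaced_hits[of X l P Z m \<epsilon> q g y w L]) auto
    moreover have "poly (map_poly of_int Z) y = real_of_int (poly Z x)"
      unfolding x(2) by (rule poly_map_poly_of_int)
    ultimately have "\<bar>real_of_int q * real_of_int (m x) - real_of_int (poly Z x)\<bar> < 1"
      unfolding x(2) by (simp add: algebra_simps abs_le_iff abs_less_iff)
    then have "\<bar>q * m x - poly Z x\<bar> < 1"
      by (metis of_int_1_less_iff of_int_abs of_int_diff of_int_less_1_iff of_int_mult)
    then show ?thesis by simp
  qed
  have large: "l \<le> card (E \<inter> {b..<b + int k})"
    if "L \<le> real k" "l * real k \<le> L * card (E \<inter> {b..<b + int k})" for b k
  proof -
    have "l * L \<le> L * card (E \<inter> {b..<b + int k})"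
      using that mult_left_mono[of L k l] by simp
    then show ?thesis using \<open>L \<ge> 1\<close> by (simp add: mult.commute)
  qed
  show ?case
  \<comment> \<open>Below the threshold the window is shorter than \<open>4 * L\<close>, because
    \<open>L \<ge> 1\<close>; above it both halves still have length at least
    \<open>L\<close>.\<close>
  proof (cases "real n < 2 * L + 2")
    case True
    let ?I = "{a..<a + int n}"
    obtain X where X: "X \<subseteq> E \<inter> ?I" "card X = l"
      using obtain_subset_with_card_n[OF large[OF less.prems]] by metis
    have "finite X" "X \<noteq> {}"
      using X \<open>l > 0\<close> card_gt_0_iff[of X] by auto
    have near: "\<bar>real_of_int x - real_of_int z\<bar> \<le> 4 * L" if "x \<in> ?I" "z \<in> ?I" for x z
    proof -
      have "\<bar>x - z\<bar> \<le> int n" using that by auto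
      then have "real_of_int \<bar>x - z\<bar> \<le> n" by linarith
      then show ?thesis using True \<open>L \<ge> 1\<close> by simp
    qed
    have near': "\<bar>real_of_int x - real_of_int z\<bar> \<le> 4 * L" if "x \<in> X" "z \<in> X" for x z
    proof -
      have "x \<in> ?I" "z \<in> ?I" using that X(1) by auto
      then show ?thesis using near[of x z] by simp
    qed
    obtain q Z where q: "1 \<le> q" "q \<le> ?Q" and Z: "degree Z < l" "\<forall>x\<in>X. poly Z x = q * m x"
      using integer_interpolation[OF \<open>finite X\<close> \<open>X \<noteq> {}\<close> near', of m] X(2) by auto
    have "poly Z x = q * m x" if x: "x \<in> E \<inter> ?I" for x
    proof (rule extend[of X Z q 1 x "4 * L" x])
      show "1 \<le> \<bar>real_of_int x - real_of_int z\<bar>" if "x \<noteq> z" for x z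
        using that by linarith
    qed (use X Z q x near \<open>finite X\<close> \<open>L \<ge> 1\<close> in auto)
    then show ?thesis using q Z(1) by blast
  next
    case False
    let ?I = "{a..<a + int n}"
    define n1 where "n1 = n div 2"
    define n2 where "n2 = n - n1"
    have n12: "n = n1 + n2" "real n \<le> 2 * n1 + 1" "n1 \<le> n2"
      by (auto simp: n1_def n2_def)
    have n1: "L \<le> n1" "L \<le> n2" using False n12 by linarith+
    have "n1 < n" "n2 < n" using n1 n12(1) \<open>L \<ge> 1\<close> by linarith+
    have split: "E \<inter> ?I = (E \<inter> {a..<a + int n1}) \<union> (E \<inter> {a + n1..<a + n1 + int n2})"
      using n12(1) by auto
    have "card (E \<inter> ?I) \<le> card (E \<inter> {a..<a + int n1}) + card (E \<inter> {a + n1..<a + n1 + int n2})"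
      unfolding split by (rule card_Un_le)
    then have "L * real (card (E \<inter> ?I)) \<le> L * (real (card (E \<inter> {a..<a + int n1})) + card (E \<inter> {a + n1..<a + n1 + int n2}))"
      using \<open>L \<ge> 1\<close> by (intro mult_left_mono) auto
    moreover have "l * real n = l * real n1 + l * real n2"
      by (simp add: n12(1) algebra_simps)
    ultimately have "l * real n1 \<le> L * card (E \<inter> {a..<a + int n1}) \<or>
        l * real n2 \<le> L * card (E \<inter> {a + n1..<a + n1 + int n2})"
      using less.prems(2) by (simp add: distrib_left) linarith
    \<comment> \<open>The factor 3 comes from \<open>n \<le> 2 * n1 + 1 \<le> 3 * n1\<close>.
      Together with \<open>k \<le> 2 * L * g\<close> it bounds the whole window by
      \<open>6 * L * g\<close>.\<close>
    then obtain b k where bk: "L \<le> real k" "l * real k \<le> L * card (E \<inter> {b..<b + int k})"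
      "k < n" "real n \<le> 3 * k" "{b..<b + int k} \<subseteq> ?I"
    proof
      assume "l * real n1 \<le> L * card (E \<inter> {a..<a + int n1})"
      then show ?thesis using that[of n1 a] n1 n12 \<open>n1 < n\<close> \<open>L \<ge> 1\<close> by auto
    next
      assume "l * real n2 \<le> L * card (E \<inter> {a + n1..<a + n1 + int n2})"
      then show ?thesis using that[of n2 "a + n1"] n1 n12 \<open>n2 < n\<close> \<open>L \<ge> 1\<close> by auto
    qed
    let ?E = "E \<inter> {b..<b + int k}"
    \<comment> \<open>The curve of the half serves the whole window unchanged, so the bound on
      \<open>q\<close> does not deteriorate from scale to scale.\<close>
    obtain q Z where q: "1 \<le> q" "q \<le> ?Q" and Z: "degree Z < l" "\<forall>x\<in>?E. poly Z x = q * m x"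
      using less.IH[OF bk(3,1,2)] by blast
    obtain X g where X: "X \<subseteq> ?E" "card X = l" and g: "0 < g" "real k \<le> 2 * L * g"
      and gap: "\<forall>x\<in>X. \<forall>z\<in>X. x \<noteq> z \<longrightarrow> g \<le> \<bar>real_of_int x - real_of_int z\<bar>"
      using dense_set_has_spaced_subset[OF _ \<open>l > 0\<close> \<open>L \<ge> 1\<close> bk(1,2)] by auto
    have "finite X"
      using X finite_subset by blast
    have "poly Z x = q * m x" if x: "x \<in> E \<inter> ?I" for x
    proof (rule extend[of X Z q g x "real n" x])
      show "\<bar>real_of_int x - real_of_int z\<bar> \<le> real n" if z: "z \<in> X" for z
      proof -
        have "z \<in> ?I" using z X bk(5) by auto
        then have "\<bar>x - z\<bar> \<le> int n" using x by auto
        then show ?thesis by linarith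
      qed
      show "real n \<le> 6 * L * g" using g(2) bk(4) by linarith
    qed (use X Z q x g gap \<open>finite X\<close> in auto)
    then show ?thesis using q Z(1) by blast
  qed
qed

text \<open>Once all hits lie exactly on one curve, a single interpolation through well-spaced hits
  of the full window controls \<open>q * P - Z\<close> at every real point of it. The bound on
  \<open>q * \<epsilon>\<close> is kept in order to pass from \<open>P\<close> to \<open>f\<close>
  later.\<close>

lemma dense_hits_imp_rational_curve:
  fixes P :: "real poly" and m :: "int \<Rightarrow> int" and E :: "int set" and L \<epsilon> :: real
  assumes deg: "degree P < l" and "L \<ge> 1"
    and hit: "\<And>x. x \<in> E \<Longrightarrow> \<bar>poly P x - m x\<bar> \<le> \<epsilon>" and "\<epsilon> > 0"
    and small: "l * (6 * L) ^ (l - 1) * ((4 * L) ^ (l * (l - 1)) * \<epsilon>) < 1 / 2"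
    and E: "E \<subseteq> {0..<int H}" and H: "L \<le> real H" "l * real H \<le> L * card E"
  shows "\<exists>(q::int) Z. 1 \<le> q \<and> q \<le> (4 * L) ^ (l * (l - 1)) \<and> q * \<epsilon> < 1 / 2 \<and> degree Z < l \<and>
      (\<forall>y. 0 \<le> y \<and> y \<le> real H \<longrightarrow> \<bar>q * poly P y - poly (map_poly of_int Z) y\<bar> < 1 / 2)"
proof -
  let ?Q = "(4 * L) ^ (l * (l - 1))"
  let ?K = "l * (6 * L) ^ (l - 1)"
  have EH: "E \<inter> {0..<0 + int H} = E" using E by auto
  obtain q Z where q: "1 \<le> q" "q \<le> ?Q" and Z: "degree Z < l" "\<forall>x\<in>E. poly Z x = q * m x"
    using hits_on_rational_curve[where E = E and a = 0 and n = H and P = P and m = m, OF deg \<open>L \<ge> 1\<close> hit small H(1)]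
    unfolding EH using H(2) by blast
  have "l > 0" using deg by simp
  have K: "1 \<le> ?K"
    using \<open>l > 0\<close> \<open>L \<ge> 1\<close> mult_mono[of 1 "real l" 1 "(6 * L) ^ (l - 1)"] one_le_power[of "6 * L" "l - 1"]
    by simp
  have "?K * (q * \<epsilon>) \<le> ?K * (?Q * \<epsilon>)"
    using q(2) \<open>\<epsilon> > 0\<close> K by (intro mult_left_mono mult_right_mono) auto
  with small have 1: "?K * (q * \<epsilon>) < 1 / 2" by linarith
  have "0 \<le> q * \<epsilon>" using \<open>\<epsilon> > 0\<close> q by simp
  then have 2: "q * \<epsilon> < 1 / 2"
    using mult_right_mono[OF K] 1 by fastforce
  have "finite E" using E finite_subset by blast
  obtain X g where X: "X \<subseteq> E" "card X = l" and g: "0 < g" "real H \<le> 2 * L * g"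
    and gap: "\<forall>x\<in>X. \<forall>z\<in>X. x \<noteq> z \<longrightarrow> g \<le> \<bar>real_of_int x - real_of_int z\<bar>"
    using dense_set_has_spaced_subset[OF \<open>finite E\<close> \<open>l > 0\<close> \<open>L \<ge> 1\<close> H] by auto
  have "finite X"
    using X \<open>finite E\<close> finite_subset by blast
  have "\<bar>q * poly P y - poly (map_poly of_int Z) y\<bar> < 1 / 2" if y: "0 \<le> y" "y \<le> real H" for y
  proof -
    have "\<bar>q * poly P y - poly (map_poly of_int Z) y\<bar> \<le> ?K * (q * \<epsilon>)"
    proof (rule curve_bound_of_spaced_hits[of X l P Z m \<epsilon> q g y "real H" L])
      show "\<bar>y - real_of_int x\<bar> \<le> real H" if "x \<in> X" for x
      proof -
        have "0 \<le> x" "x < int H" using that X E by auto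
        then have "0 \<le> real_of_int x" "real_of_int x \<le> H" by linarith+
        then show ?thesis using y by linarith
      qed
      have "L * g \<ge> 0" using \<open>L \<ge> 1\<close> g by simp
      then show "real H \<le> 6 * L * g" using g(2) by linarith
    qed (use X Z q \<open>finite X\<close> g gap deg hit in auto)
    with 1 show ?thesis by linarith
  qed
  then show ?thesis using q Z(1) 2 by blast
qed

section \<open>Sign patterns and residue classes\<close>

text \<open>The labels \<open>\<phi>\<close> number the pieces of \<open>[a, b]\<close> on which \<open>G 0\<close> has constant sign: a function whose
  derivative has constant sign on an interval changes its own sign there at most once.\<close>

lemma exists_sign_labelling:
  fixes G :: "nat \<Rightarrow> real \<Rightarrow> real"
  assumes "\<And>j y. j < n \<Longrightarrow> a \<le> y \<Longrightarrow> y \<le> b \<Longrightarrow> (G j has_real_derivative G (Suc j) y) (at y)"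
    and "(\<forall>y\<in>{a..b}. G n y < 0) \<or> (\<forall>y\<in>{a..b}. 0 \<le> G n y)"
  shows "\<exists>\<phi>::real \<Rightarrow> nat. (\<forall>y. \<phi> y < 2 ^ n) \<and>
    (\<forall>x\<in>{a..b}. \<forall>y\<in>{a..b}. \<forall>z\<in>{a..b}. x \<le> y \<longrightarrow> y \<le> z \<longrightarrow> \<phi> x = \<phi> z \<longrightarrow> \<phi> y = \<phi> x) \<and>
    (\<forall>x\<in>{a..b}. \<forall>y\<in>{a..b}. \<phi> x = \<phi> y \<longrightarrow> (G 0 x < 0 \<longleftrightarrow> G 0 y < 0))"
  using assms
proof (induction n arbitrary: G)
  case 0
  then show ?case by (intro exI[of _ "\<lambda>_. 0"]) (auto simp: not_less[symmetric])
next
  case (Suc n)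
  have "\<exists>\<phi>::real \<Rightarrow> nat. (\<forall>y. \<phi> y < 2 ^ n) \<and>
    (\<forall>x\<in>{a..b}. \<forall>y\<in>{a..b}. \<forall>z\<in>{a..b}. x \<le> y \<longrightarrow> y \<le> z \<longrightarrow> \<phi> x = \<phi> z \<longrightarrow> \<phi> y = \<phi> x) \<and>
    (\<forall>x\<in>{a..b}. \<forall>y\<in>{a..b}. \<phi> x = \<phi> y \<longrightarrow> (G (Suc 0) x < 0 \<longleftrightarrow> G (Suc 0) y < 0))"
    using Suc.prems by (intro Suc.IH[of "\<lambda>j. G (Suc j)"]) auto
  then obtain \<phi> :: "real \<Rightarrow> nat" where bound: "\<And>y. \<phi> y < 2 ^ n"
    and between: "\<And>x y z. x \<in> {a..b} \<Longrightarrow> y \<in> {a..b} \<Longrightarrow> z \<in> {a..b} \<Longrightarrow> x \<le> y \<Longrightarrow> y \<le> z \<Longrightarrow>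
      \<phi> x = \<phi> z \<Longrightarrow> \<phi> y = \<phi> x"
    and sgn: "\<And>x y. x \<in> {a..b} \<Longrightarrow> y \<in> {a..b} \<Longrightarrow> \<phi> x = \<phi> y \<Longrightarrow> (G (Suc 0) x < 0 \<longleftrightarrow> G (Suc 0) y < 0)"
    by blast
  have der: "(G 0 has_real_derivative G (Suc 0) y) (at y)" if "y \<in> {a..b}" for y
    using Suc.prems(1)[of 0 y] that by auto
  \<comment> \<open>The old label is refined by one bit, the sign of \<open>G 0\<close>. Between two
    points with equal old label \<open>G 0\<close> is monotone, so it cannot lose its sign and
    regain it.\<close>
  define \<psi> where "\<psi> y = 2 * \<phi> y + (if G 0 y < 0 then 1 else 0)" for y
  have \<psi>_eq: "\<psi> x = \<psi> y \<longleftrightarrow> \<phi> x = \<phi> y \<and> (G 0 x < 0 \<longleftrightarrow> G 0 y < 0)" for x y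
    unfolding \<psi>_def by (cases "G 0 x < 0"; cases "G 0 y < 0"; simp; presburger?)
  have "\<psi> y = \<psi> x" if xyz: "x \<in> {a..b}" "y \<in> {a..b}" "z \<in> {a..b}" "x \<le> y" "y \<le> z" and eq: "\<psi> x = \<psi> z" for x y z
  proof -
    have \<phi>: "\<phi> u = \<phi> x" if "x \<le> u" "u \<le> z" for u
      using between[of x u z] xyz eq that by (auto simp: \<psi>_eq)
    have der': "(G 0 has_real_derivative G (Suc 0) u) (at u)" if "x \<le> u" "u \<le> z" for u
      using der that xyz by auto
    have sgn': "G (Suc 0) u < 0 \<longleftrightarrow> G (Suc 0) x < 0" if "x \<le> u" "u \<le> z" for u
      using sgn[of u x] \<phi>[OF that] that xyz by auto
    have "G 0 y < 0 \<longleftrightarrow> G 0 x < 0"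
    proof (cases "G (Suc 0) x < 0")
      case True
      have np: "\<exists>v. (G 0 has_real_derivative v) (at u) \<and> v \<le> 0" if "x \<le> u" "u \<le> z" for u
        using der'[OF that] sgn'[OF that] True by (intro exI[of _ "G (Suc 0) u"]) auto
      have "G 0 y \<le> G 0 x"
        using xyz by (intro DERIV_nonpos_imp_nonincreasing[of x y "G 0"] np) auto
      moreover have "G 0 z \<le> G 0 y"
        using xyz by (intro DERIV_nonpos_imp_nonincreasing[of y z "G 0"] np) auto
      ultimately show ?thesis using eq by (auto simp: \<psi>_eq)
    next
      case False
      have nn: "\<exists>v. (G 0 has_real_derivative v) (at u) \<and> 0 \<le> v" if "x \<le> u" "u \<le> z" for u
        using der'[OF that] sgn'[OF that] False by (intro exI[of _ "G (Suc 0) u"]) auto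
      have "G 0 x \<le> G 0 y"
        using xyz by (intro DERIV_nonneg_imp_nondecreasing[of x y "G 0"] nn) auto
      moreover have "G 0 y \<le> G 0 z"
        using xyz by (intro DERIV_nonneg_imp_nondecreasing[of y z "G 0"] nn) auto
      ultimately show ?thesis using eq by (auto simp: \<psi>_eq)
    qed
    then show ?thesis using \<phi>[of y] xyz by (simp add: \<psi>_eq)
  qed
  moreover have "\<psi> y < 2 ^ Suc n" for y
    using bound[of y] by (simp add: \<psi>_def)
  ultimately show ?case
    using \<psi>_eq by (intro exI[of _ \<psi>]) blast
qed

text \<open>By \<open>between\<close>, the set is the whole of its residue class from its minimum to
  its maximum.\<close>

lemma arith_prog_residue_class:
  fixes A :: "nat set"
  assumes "finite A" "A \<noteq> {}" "1 \<le> q"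
    and cong: "\<And>x y. x \<in> A \<Longrightarrow> y \<in> A \<Longrightarrow> x mod q = y mod q"
    and between: "\<And>x y z. x \<in> A \<Longrightarrow> z \<in> A \<Longrightarrow> x \<le> y \<Longrightarrow> y \<le> z \<Longrightarrow> y mod q = x mod q \<Longrightarrow> y \<in> A"
  shows "arith_prog A q"
proof -
  define a b where "a = Min A" and "b = Max A"
  have ab: "a \<in> A" "b \<in> A" "\<And>x. x \<in> A \<Longrightarrow> a \<le> x \<and> x \<le> b"
    using assms(1,2) by (auto simp: a_def b_def)
  have "A = (\<lambda>i. a + q * i) ` {..<(b - a) div q + 1}"
  proof (intro set_eqI iffI)
    fix x assume x: "x \<in> A"
    have "q dvd x - a"
      using cong[OF x ab(1)] ab(3)[OF x] by (metis mod_eq_dvd_iff_nat)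
    then obtain i where i: "x - a = q * i" by blast
    have "q * i \<le> b - a" using ab(3)[OF x] i by linarith
    then have "i \<le> (b - a) div q"
      using \<open>1 \<le> q\<close> by (simp add: less_eq_div_iff_mult_less_eq mult.commute)
    then show "x \<in> (\<lambda>i. a + q * i) ` {..<(b - a) div q + 1}"
      using ab(3)[OF x] i by (intro image_eqI[of _ _ i]) auto
  next
    fix x assume "x \<in> (\<lambda>i. a + q * i) ` {..<(b - a) div q + 1}"
    then obtain i where i: "x = a + q * i" and "i < (b - a) div q + 1" by blast
    then have i2: "i \<le> (b - a) div q" by simp
    have "q * i \<le> b - a"
      using i2 \<open>1 \<le> q\<close> by (simp add: less_eq_div_iff_mult_less_eq mult.commute)
    then have "a + q * i \<le> b"
      using ab(3)[OF ab(1)] by linarith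
    then show "x \<in> A"
      unfolding i using between[OF ab(1) ab(2)] by simp
  qed
  then show ?thesis
    unfolding arith_prog_def using \<open>1 \<le> q\<close> by (intro conjI exI[of _ a] exI[of _ "(b - a) div q + 1"]) auto
qed

text \<open>The blocks are the nonempty intersections of a residue class mod \<open>q\<close> with a
  level set of \<open>\<psi>\<close>. Level sets are intervals of \<open>{..<H}\<close>, so each
  block is a progression with step \<open>q\<close>.\<close>

lemma partition_by_residue_and_label:
  fixes \<psi> :: "nat \<Rightarrow> 'b" and e :: "nat \<Rightarrow> 'c"
  assumes "1 \<le> q" and C: "finite C" "\<And>h. \<psi> h \<in> C"
    and between: "\<And>x y z. x \<le> y \<Longrightarrow> y \<le> z \<Longrightarrow> z < H \<Longrightarrow> \<psi> x = \<psi> z \<Longrightarrow> \<psi> y = \<psi> x"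
    and e: "\<And>x y. x < H \<Longrightarrow> y < H \<Longrightarrow> x mod q = y mod q \<Longrightarrow> \<psi> x = \<psi> y \<Longrightarrow> e x = e y"
  shows "\<exists>P. partition_on {..<H} P \<and> finite P \<and> card P \<le> q * card C \<and>
    (\<forall>S\<in>P. arith_prog S q) \<and> (\<forall>S\<in>P. \<forall>h\<in>S. \<forall>h'\<in>S. e h = e h')"
proof -
  define cls where "cls p = {h. h < H \<and> h mod q = fst p \<and> \<psi> h = snd p}" for p
  define P where "P = cls ` ({..<q} \<times> C) - {{}}"
  have "partition_on {..<H} P"
  proof (rule partition_onI)
    have "h \<in> \<Union>P" if "h < H" for h
    proof
      show h: "h \<in> cls (h mod q, \<psi> h)"
        using that by (simp add: cls_def)
      have "cls (h mod q, \<psi> h) \<in> cls ` ({..<q} \<times> C)"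
        using C \<open>1 \<le> q\<close> by (intro imageI) simp
      with h show "cls (h mod q, \<psi> h) \<in> P"
        unfolding P_def by blast
    qed
    then have "{..<H} \<subseteq> \<Union>P" by auto
    moreover have "\<Union>P \<subseteq> {..<H}"
      by (auto simp: P_def cls_def)
    ultimately show "\<Union>P = {..<H}" by auto
  next
    fix S T assume "S \<in> P" "T \<in> P" "S \<noteq> T"
    then show "disjnt S T"
      by (auto simp: P_def cls_def disjnt_def)
  qed (auto simp: P_def)
  moreover have fin: "finite P"
    using C by (simp add: P_def)
  moreover have "card P \<le> q * card C"
  proof -
    have "card P \<le> card (cls ` ({..<q} \<times> C))"
      unfolding P_def using C by (intro card_mono) auto
    also have "\<dots> \<le> card ({..<q} \<times> C)"
      using C by (intro card_image_le) auto
    finally show ?thesis by (simp add: card_cartesian_product)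
  qed
  moreover have "arith_prog S q" if S: "S \<in> P" for S
  proof -
    obtain p where p: "S = cls p" "S \<noteq> {}"
      using S by (auto simp: P_def)
    have "S \<subseteq> {..<H}" by (auto simp: p cls_def)
    show ?thesis
    proof (rule arith_prog_residue_class)
      show "finite S" using \<open>S \<subseteq> {..<H}\<close> finite_subset by blast
      show "y \<in> S" if "x \<in> S" "z \<in> S" "x \<le> y" "y \<le> z" "y mod q = x mod q" for x y z
        using that between[of x y z] by (auto simp: p cls_def)
    qed (use p \<open>1 \<le> q\<close> in \<open>auto simp: cls_def\<close>)
  qed
  moreover have "e h = e h'" if "S \<in> P" "h \<in> S" "h' \<in> S" for S h h'
    using that e[of h h'] by (auto simp: P_def cls_def)
  ultimately show ?thesis by blast
qed

text \<open>Write \<open>z = q * t + r\<close>. If \<open>r \<noteq> 0\<close>, then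
  \<open>q * t \<le> z - 1 < q * x < z + 1 \<le> q * (t + 1)\<close> pins the floor to
  \<open>t\<close>. If \<open>r = 0\<close>, then \<open>x\<close> is within \<open>1 / q\<close> of
  the integer \<open>t\<close>, and only the side on which it lies matters.\<close>

lemma floor_near_rational:
  fixes x :: real and z q :: int
  assumes "1 \<le> q" "\<bar>q * x - z\<bar> < 1"
  shows "\<lfloor>x\<rfloor> = z div q - (if q dvd z \<and> x < z / q then 1 else 0)"
proof -
  have q: "0 < real_of_int q" using assms(1) by simp
  define t r where "t = z div q" and "r = z mod q"
  have z: "z = q * t + r" and r: "0 \<le> r" "r < q"
    using assms(1) by (auto simp: t_def r_def)
  have lo: "real_of_int z - 1 < q * x" and hi: "q * x < real_of_int z + 1"
    using assms(2) by linarith+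
  have lt: "x < of_int u" if "q * x < real_of_int q * of_int u" for u
    using that q by simp
  have le: "of_int u \<le> x" if "real_of_int q * of_int u \<le> q * x" for u
    using that q by simp
  have dvd: "q dvd z \<longleftrightarrow> r = 0"
    by (auto simp: r_def)
  have "z + 1 \<le> q * (t + 1)" using z r by (simp add: algebra_simps)
  then have "real_of_int (z + 1) \<le> real_of_int (q * (t + 1))"
    by (simp only: of_int_le_iff)
  then have "real_of_int z + 1 \<le> real_of_int q * of_int (t + 1)"
    by simp
  then have up: "x < of_int (t + 1)" using hi by (intro lt) linarith
  show ?thesis
  proof (cases "r = 0")
    case False
    then have "q * t \<le> z - 1" using z r by simp
    then have "real_of_int (q * t) \<le> real_of_int (z - 1)"
      by (simp only: of_int_le_iff)
    then have "real_of_int q * of_int t \<le> real_of_int z - 1"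
      by simp
    then have "of_int t \<le> x" using lo by (intro le) linarith
    then have "\<lfloor>x\<rfloor> = t" using up by (intro floor_unique) auto
    with False show ?thesis by (simp add: dvd t_def[symmetric])
  next
    case True
    then have zt: "real_of_int z = real_of_int q * of_int t" using z by simp
    have "real_of_int q * of_int (t - 1) \<le> real_of_int z - 1"
      using assms(1) by (simp add: zt algebra_simps)
    then have lo': "of_int (t - 1) \<le> x" using lo by (intro le) linarith
    have "z / q = of_int t" using zt q by simp
    moreover have "\<lfloor>x\<rfloor> = t - (if x < of_int t then 1 else 0)"
      using up lo' by (intro floor_unique) (auto split: if_splits)
    ultimately show ?thesis
      using True by (simp add: dvd t_def[symmetric])
  qed
qed

section \<open>Growth of derivatives in a Hardy field\<close>

lemma derivs_at_of_derivs_within: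
  fixes D :: "nat \<Rightarrow> real \<Rightarrow> real"
  assumes "\<forall>j. \<forall>t\<ge>1. (D j has_real_derivative D (Suc j) t) (at t within {1..})"
  shows "\<forall>j. \<forall>t>1. (D j has_real_derivative D (Suc j) t) (at t)"
proof (intro allI impI)
  fix j t assume "1 < (t::real)"
  then have "at t within {1..} = at t"
    by (intro at_within_interior) auto
  then show "(D j has_real_derivative D (Suc j) t) (at t)"
    using assms \<open>1 < t\<close> by (metis less_imp_le)
qed

text \<open>Functions that agree on a half-line have equal derivatives on its interior, so closure
  under differentiation passes from germs to the family \<open>D\<close>. All derivatives thus lie
  in one Hardy field.\<close>

lemma hardy_field_derivs:
  fixes f :: "real \<Rightarrow> real" and D :: "nat \<Rightarrow> real \<Rightarrow> real"
  assumes F: "hardy_field F" "g \<in> F" "\<forall>\<^sub>F t in at_top. f t = g t"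
    and D: "\<forall>t\<ge>1. D 0 t = f t"
      "\<forall>j. \<forall>t>1. (D j has_real_derivative D (Suc j) t) (at t)"
  shows "\<exists>g\<in>F. \<forall>\<^sub>F t in at_top. D j t = g t"
proof (induction j)
  case 0
  have "\<forall>\<^sub>F t in at_top. D 0 t = g t"
    using F(3) eventually_ge_at_top[of 1] by eventually_elim (use D(1) in auto)
  then show ?case using F(2) by blast
next
  case (Suc j)
  then obtain g where g: "g \<in> F" "\<forall>\<^sub>F t in at_top. D j t = g t" by blast
  then obtain g' where g': "g' \<in> F" "\<forall>\<^sub>F t in at_top. (g has_real_derivative g' t) (at t)"
    using F(1) unfolding hardy_field_def by blast
  obtain T where T: "\<And>t. t \<ge> T \<Longrightarrow> D j t = g t"
    using g(2) by (auto simp: eventually_at_top_linorder)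
  have "\<forall>\<^sub>F t in at_top. D (Suc j) t = g' t"
    using g'(2) eventually_gt_at_top[of T] eventually_gt_at_top[of 1]
  proof eventually_elim
    case (elim t)
    have "(D j has_real_derivative g' t) (at t)"
      using elim(1) by (rule DERIV_cong_ev[THEN iffD1, rotated -1])
        (use elim T in \<open>auto intro!: eventually_nhds_in_open[THEN eventually_mono, of "{T<..}"]\<close>)
    then show ?case using D(2) elim(3) DERIV_unique by blast
  qed
  then show ?case using g'(1) by blast
qed

text \<open>A nonzero germ is invertible, so \<open>h\<close> eventually has no zeros and, being
  continuous, keeps its sign. The zero germ falls under the second alternative.\<close>

lemma hardy_eventually_const_sign:
  fixes h :: "real \<Rightarrow> real"
  assumes F: "hardy_field F" "g \<in> F" "\<forall>\<^sub>F t in at_top. h t = g t"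
    and cont: "continuous_on {1..} h"
  shows "(\<forall>\<^sub>F t in at_top. h t < 0) \<or> (\<forall>\<^sub>F t in at_top. 0 \<le> h t)"
proof (cases "\<forall>\<^sub>F t in at_top. g t = 0")
  case True
  with F(3) have "\<forall>\<^sub>F t in at_top. 0 \<le> h t" by eventually_elim simp
  then show ?thesis ..
next
  case False
  then obtain g' where "\<forall>\<^sub>F t in at_top. g t * g' t = 1"
    using F(1,2) unfolding hardy_field_def by blast
  with F(3) have "\<forall>\<^sub>F t in at_top. h t \<noteq> 0"
    by eventually_elim auto
  then obtain T where "\<And>t. t \<ge> T \<Longrightarrow> h t \<noteq> 0"
    by (auto simp: eventually_at_top_linorder)
  then have nz: "h t \<noteq> 0" if "t \<ge> max 1 T" for t using that by auto
  have same: "h t < 0 \<longleftrightarrow> h (max 1 T) < 0" if t: "t \<ge> max 1 T" for t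
  proof (rule ccontr)
    assume *: "(h t < 0) \<noteq> (h (max 1 T) < 0)"
    have "continuous_on {max 1 T..t} h"
      by (rule continuous_on_subset[OF cont]) auto
    then have "\<exists>x\<ge>max 1 T. x \<le> t \<and> h x = 0"
      using * t IVT'[of h "max 1 T" 0 t] IVT2'[of h t 0 "max 1 T"] by (cases "h t < 0") auto
    then show False using nz by blast
  qed
  show ?thesis
  proof (cases "h (max 1 T) < 0")
    case True
    then have "\<forall>t\<ge>max 1 T. h t < 0" using same by blast
    then have "\<forall>\<^sub>F t in at_top. h t < 0"
      unfolding eventually_at_top_linorder by blast
    then show ?thesis ..
  next
    case False
    then have "\<forall>t\<ge>max 1 T. 0 \<le> h t" using same not_less by metis
    then have "\<forall>\<^sub>F t in at_top. 0 \<le> h t"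
      unfolding eventually_at_top_linorder by blast
    then show ?thesis ..
  qed
qed

text \<open>The mean value theorem on \<open>[t/2, t]\<close> and \<open>[t, 2t]\<close> sandwiches the monotone derivative at \<open>t\<close>.\<close>

lemma deriv_bound_of_mono_deriv:
  fixes g g' :: "real \<Rightarrow> real"
  assumes der: "\<And>t. t \<ge> T \<Longrightarrow> (g has_real_derivative g' t) (at t)" and "T > 0"
    and mono: "\<And>s t. T \<le> s \<Longrightarrow> s \<le> t \<Longrightarrow> g' s \<le> g' t"
    and bd: "\<And>t. t \<ge> T \<Longrightarrow> \<bar>g t\<bar> \<le> C * t powr a"
    and t: "t \<ge> 2 * T"
  shows "\<bar>g' t\<bar> \<le> C * (3 + 2 powr a + 2 * (1 / 2) powr a) * t powr (a - 1)"
proof -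
  have "t > 0" "t / 2 \<ge> T" "t \<ge> T" "2 * t \<ge> T" using t \<open>T > 0\<close> by auto
  obtain \<xi> where \<xi>: "t < \<xi>" "g (2 * t) - g t = (2 * t - t) * g' \<xi>"
    using MVT2[of t "2 * t" g g'] der \<open>t > 0\<close> \<open>t \<ge> T\<close> by auto
  obtain \<zeta> where \<zeta>: "t / 2 < \<zeta>" "\<zeta> < t" "g t - g (t / 2) = (t - t / 2) * g' \<zeta>"
    using MVT2[of "t / 2" t g g'] der \<open>t > 0\<close> \<open>t / 2 \<ge> T\<close> by auto
  have "t * g' t \<le> g (2 * t) - g t"
    using mono[of t \<xi>] \<xi> \<open>t > 0\<close> \<open>t \<ge> T\<close> by simp
  moreover have "2 * (g t - g (t / 2)) \<le> t * g' t"
  proof -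
    have "t * g' \<zeta> \<le> t * g' t"
      using mono[of \<zeta> t] \<zeta>(1,2) \<open>t > 0\<close> \<open>t / 2 \<ge> T\<close> by (intro mult_left_mono) auto
    then show ?thesis using \<zeta>(3) by (simp add: field_simps)
  qed
  moreover have "\<bar>g t\<bar> \<le> C * t powr a" using bd \<open>t \<ge> T\<close> by simp
  moreover have "\<bar>g (2 * t)\<bar> \<le> C * t powr a * 2 powr a"
    using bd[OF \<open>2 * t \<ge> T\<close>] \<open>t > 0\<close> by (simp add: powr_mult mult_ac)
  moreover have "\<bar>g (t / 2)\<bar> \<le> C * t powr a * (1 / 2) powr a"
    using bd[OF \<open>t / 2 \<ge> T\<close>] \<open>t > 0\<close> powr_mult[of t "1 / 2" a] by (simp add: mult_ac)
  moreover have "C * t powr a \<ge> 0" using bd[OF \<open>t \<ge> T\<close>] by linarith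
  moreover from this have "0 \<le> C * t powr a * 2 powr a" "0 \<le> C * t powr a * (1 / 2) powr a" by simp_all
  ultimately have "\<bar>t * g' t\<bar> \<le> C * t powr a * 3 + C * t powr a * 2 powr a + 2 * (C * t powr a * (1 / 2) powr a)"
    by (simp add: abs_le_iff)
  also have "\<dots> = t * (C * (3 + 2 powr a + 2 * (1 / 2) powr a) * t powr (a - 1))"
    using \<open>t > 0\<close> by (simp add: powr_diff algebra_simps)
  finally show ?thesis
    using \<open>t > 0\<close> by (simp add: abs_mult)
qed

text \<open>The sign of \<open>g''\<close> makes \<open>g'\<close> eventually monotone; the
  decreasing case is reduced to the increasing one by passing to \<open>- g\<close>.\<close>

lemma eventually_deriv_bound:
  fixes g g' g'' :: "real \<Rightarrow> real"
  assumes der: "\<forall>\<^sub>F t in at_top. (g has_real_derivative g' t) (at t)"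
      "\<forall>\<^sub>F t in at_top. (g' has_real_derivative g'' t) (at t)"
    and sgn: "(\<forall>\<^sub>F t in at_top. g'' t < 0) \<or> (\<forall>\<^sub>F t in at_top. 0 \<le> g'' t)"
    and bd: "C > 0" "\<forall>\<^sub>F t in at_top. \<bar>g t\<bar> \<le> C * t powr a"
  shows "\<exists>C>0. \<forall>\<^sub>F t in at_top. \<bar>g' t\<bar> \<le> C * t powr (a - 1)"
proof -
  define C' where "C' = C * (3 + 2 powr a + 2 * (1 / 2) powr a)"
  have "C' > 0"
    unfolding C'_def using bd(1) by (intro mult_pos_pos add_pos_nonneg) auto
  have "\<forall>\<^sub>F t in at_top. \<bar>g' t\<bar> \<le> C' * t powr (a - 1)"
    using sgn
  proof
    assume "\<forall>\<^sub>F t in at_top. 0 \<le> g'' t"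
    then have "\<forall>\<^sub>F t in at_top. (g has_real_derivative g' t) (at t) \<and> (g' has_real_derivative g'' t) (at t)
        \<and> \<bar>g t\<bar> \<le> C * t powr a \<and> 0 \<le> g'' t \<and> t > 0"
      using der bd(2) eventually_gt_at_top[of 0] by eventually_elim auto
    then obtain T where T: "\<And>t. t \<ge> T \<Longrightarrow> (g has_real_derivative g' t) (at t) \<and> (g' has_real_derivative g'' t) (at t)
        \<and> \<bar>g t\<bar> \<le> C * t powr a \<and> 0 \<le> g'' t \<and> t > 0"
      unfolding eventually_at_top_linorder by blast
    have "\<bar>g' t\<bar> \<le> C' * t powr (a - 1)" if "t \<ge> 2 * T" for t
      unfolding C'_def
    proof (rule deriv_bound_of_mono_deriv[OF _ _ _ _ that])
      show "g' x \<le> g' y" if "T \<le> x" "x \<le> y" for x y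
        using that DERIV_nonneg_imp_nondecreasing[of x y g'] T by (meson order_trans)
    qed (use T in auto)
    then show ?thesis unfolding eventually_at_top_linorder by blast
  next
    assume "\<forall>\<^sub>F t in at_top. g'' t < 0"
    then have "\<forall>\<^sub>F t in at_top. (g has_real_derivative g' t) (at t) \<and> (g' has_real_derivative g'' t) (at t)
        \<and> \<bar>g t\<bar> \<le> C * t powr a \<and> g'' t \<le> 0 \<and> t > 0"
      using der bd(2) eventually_gt_at_top[of 0] by eventually_elim auto
    then obtain T where T: "\<And>t. t \<ge> T \<Longrightarrow> (g has_real_derivative g' t) (at t) \<and> (g' has_real_derivative g'' t) (at t)
        \<and> \<bar>g t\<bar> \<le> C * t powr a \<and> g'' t \<le> 0 \<and> t > 0"
      unfolding eventually_at_top_linorder by blast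
    have "\<bar>- g' t\<bar> \<le> C' * t powr (a - 1)" if "t \<ge> 2 * T" for t
      unfolding C'_def
    proof (rule deriv_bound_of_mono_deriv[where g = "\<lambda>t. - g t", OF _ _ _ _ that])
      show "- g' x \<le> - g' y" if "T \<le> x" "x \<le> y" for x y
        using that DERIV_nonpos_imp_nonincreasing[of x y g'] T by (meson neg_le_iff_le order_trans)
    qed (use T in \<open>auto intro: DERIV_minus\<close>)
    then show ?thesis unfolding eventually_at_top_linorder by auto
  qed
  with \<open>C' > 0\<close> show ?thesis by blast
qed

text \<open>Each differentiation lowers the exponent by one, monotonicity of
  \<open>D (Suc l)\<close> coming from the sign of \<open>D (Suc (Suc l))\<close>. The exponent is
  real since it becomes negative beyond order \<open>k\<close>; this decay makes the Taylor
  remainder small.\<close>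

lemma hardy_derivs_sign_and_growth:
  fixes f :: "real \<Rightarrow> real" and D :: "nat \<Rightarrow> real \<Rightarrow> real" and k :: nat
  assumes "in_hardy f"
    and growth: "C0 > 0" "\<forall>\<^sub>F t in at_top. \<bar>f t\<bar> \<le> C0 * t ^ k"
    and D0: "\<forall>t\<ge>1. D 0 t = f t"
    and D: "\<forall>j. \<forall>t\<ge>1. (D j has_real_derivative D (Suc j) t) (at t within {1..})"
  shows "(\<forall>\<^sub>F t in at_top. D l t < 0) \<or> (\<forall>\<^sub>F t in at_top. 0 \<le> D l t)"
    and "\<exists>C>0. \<forall>\<^sub>F t in at_top. \<bar>D l t\<bar> \<le> C * t powr (real k - real l)"
proof -
  note D' = derivs_at_of_derivs_within[OF D]
  obtain F g where F: "hardy_field F" "g \<in> F" "\<forall>\<^sub>F t in at_top. f t = g t"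
    using assms(1) by (auto simp: in_hardy_def)
  show sgn: "(\<forall>\<^sub>F t in at_top. D j t < 0) \<or> (\<forall>\<^sub>F t in at_top. 0 \<le> D j t)" for j
  proof -
    have "continuous_on {1..} (D j)"
      using D by (auto intro!: DERIV_continuous_on)
    then show ?thesis
      using hardy_field_derivs[OF F D0 D', of j] hardy_eventually_const_sign[OF F(1)] by blast
  qed
  have der: "\<forall>\<^sub>F t in at_top. (D j has_real_derivative D (Suc j) t) (at t)" for j
    using eventually_gt_at_top[of 1] by eventually_elim (use D' in blast)
  show "\<exists>C>0. \<forall>\<^sub>F t in at_top. \<bar>D l t\<bar> \<le> C * t powr (real k - real l)"
  proof (induction l)
    case 0
    have "\<forall>\<^sub>F t in at_top. \<bar>D 0 t\<bar> \<le> C0 * t powr (real k - real 0)"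
      using growth(2) eventually_ge_at_top[of 1]
      by eventually_elim (use D0 in \<open>auto simp: powr_realpow\<close>)
    then show ?case using growth(1) by blast
  next
    case (Suc l)
    then obtain C where "C > 0" "\<forall>\<^sub>F t in at_top. \<bar>D l t\<bar> \<le> C * t powr (real k - real l)" by blast
    from eventually_deriv_bound[OF der der sgn this] show ?case
      by (simp add: algebra_simps)
  qed
qed

section \<open>Taylor approximation\<close>

text \<open>This is the Lagrange form of the remainder, with the gain from
  \<open>fact l \<ge> 1\<close> given up.\<close>

lemma taylor_remainder_bound:
  fixes f :: "real \<Rightarrow> real" and D :: "nat \<Rightarrow> real \<Rightarrow> real"
  assumes D0: "\<forall>t\<ge>1. D 0 t = f t"
    and D: "\<forall>j. \<forall>t>1. (D j has_real_derivative D (Suc j) t) (at t)"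
    and N: "N > 1" and y: "0 \<le> y" and B: "\<And>t. t \<ge> real N \<Longrightarrow> \<bar>D l t\<bar> \<le> B"
  shows "\<bar>f (real N + y) - taylor_poly D l N y\<bar> \<le> B * y ^ l"
proof -
  have "\<exists>t\<ge>real N. f (N + y) = taylor_poly D l N y + D l t / fact l * y ^ l"
  \<comment> \<open>The mean value form needs an interval of positive length, so
    \<open>y = 0\<close> is treated apart; for \<open>l = 0\<close> the remainder is then the full
    value, by \<open>0 ^ 0 = 1\<close>.\<close>
  proof (cases "y = 0")
    case True
    have fN: "f N = D 0 N" using D0 N by simp
    have "f (N + y) = taylor_poly D l N y + D l N / fact l * y ^ l"
    proof (cases l)
      case 0
      then show ?thesis by (simp add: taylor_poly_def True fN)
    next
      case (Suc n)
      have "taylor_poly D (Suc n) N 0 = D 0 N"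
        unfolding taylor_poly_def sum.lessThan_Suc_shift by simp
      then show ?thesis by (simp add: Suc True fN)
    qed
    then show ?thesis by blast
  next
    case False
    have "\<exists>t::real. 0 < t \<and> t \<le> y \<and> D 0 (N + y) = (\<Sum>m<l. D m (real N + 0) / fact m * y ^ m) + D l (N + t) / fact l * y ^ l"
    proof (rule Maclaurin2[where diff = "\<lambda>m t. D m (real N + t)" and f = "\<lambda>t. D 0 (real N + t)"])
      show "\<forall>m (t::real). m < l \<and> 0 \<le> t \<and> t \<le> y \<longrightarrow>
          ((\<lambda>t. D m (N + t)) has_real_derivative D (Suc m) (N + t)) (at t)"
      proof (intro allI impI)
        fix m and t :: real assume "m < l \<and> 0 \<le> t \<and> t \<le> y"
        then have "(D m has_real_derivative D (Suc m) (N + t)) (at (N + t))"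
          using D N by auto
        then show "((\<lambda>t. D m (N + t)) has_real_derivative D (Suc m) (N + t)) (at t)"
          using DERIV_shift[of "D m" "D (Suc m) (real N + t)" t "real N"] by (simp add: add.commute)
      qed
    qed (use False y in auto)
    then obtain t :: real where t: "0 < t"
        "D 0 (N + y) = (\<Sum>m<l. D m (real N + 0) / fact m * y ^ m) + D l (N + t) / fact l * y ^ l"
      by blast
    have "D 0 (N + y) = f (N + y)" using D0 N y by simp
    moreover have "(\<Sum>m<l. D m (real N + 0) / fact m * y ^ m) = taylor_poly D l N y"
      by (simp add: taylor_poly_def mult_ac)
    ultimately show ?thesis
      using t by (intro exI[of _ "N + t"] conjI) simp_all
  qed
  then obtain t :: real where t: "t \<ge> N" "f (N + y) = taylor_poly D l N y + D l t / fact l * y ^ l" by blast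
  have "0 \<le> B" using B[OF t(1)] by linarith
  then have "\<bar>D l t\<bar> / fact l \<le> B / 1"
    using B[OF t(1)] by (intro frac_le) (auto simp: fact_ge_1)
  then have "\<bar>D l t\<bar> / fact l * y ^ l \<le> B * y ^ l"
    using y by (intro mult_right_mono) auto
  then show ?thesis using y t(2) by (simp add: abs_mult)
qed

section \<open>Counting functions constant on few progressions\<close>

lemma finite_bounded_subsets:
  assumes "finite T"
  shows "finite {U. U \<subseteq> T \<and> card U \<le> M}"
  using assms by (auto intro: finite_subset[of _ "Pow T"])

text \<open>A set of at most \<open>M + 1\<close> elements arises from one of at most
  \<open>M\<close> by inserting an element or, for \<open>None\<close>, nothing, which leaves
  \<open>card T + 1\<close> choices.\<close>

lemma card_bounded_subsets_le:
  assumes "finite T"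
  shows "card {U. U \<subseteq> T \<and> card U \<le> M} \<le> (card T + 1) ^ M"
proof (induction M)
  case 0
  have "{U. U \<subseteq> T \<and> card U \<le> 0} = {{}}"
    using assms by (auto dest: finite_subset)
  then show ?case by simp
next
  case (Suc M)
  let ?F = "\<lambda>M. {U. U \<subseteq> T \<and> card U \<le> M}"
  let ?ins = "\<lambda>(U, x). case x of None \<Rightarrow> U | Some t \<Rightarrow> insert t U"
  have "?F (Suc M) \<subseteq> ?ins ` (?F M \<times> insert None (Some ` T))"
  proof
    fix U assume U: "U \<in> ?F (Suc M)"
    show "U \<in> ?ins ` (?F M \<times> insert None (Some ` T))"
    proof (cases "U = {}")
      case True
      then show ?thesis by (intro image_eqI[of _ _ "({}, None)"]) auto
    next
      case False
      then obtain t where t: "t \<in> U" by blast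
      have "finite U" using U assms finite_subset by blast
      then have "card (U - {t}) \<le> M" using U t card_Diff_singleton[of t U] by auto
      then show ?thesis
        using U t by (intro image_eqI[of _ _ "(U - {t}, Some t)"]) auto
    qed
  qed
  then have "card (?F (Suc M)) \<le> card (?ins ` (?F M \<times> insert None (Some ` T)))"
    using assms by (intro card_mono) (auto intro!: finite_imageI finite_cartesian_product finite_bounded_subsets)
  also have "\<dots> \<le> card (?F M \<times> insert None (Some ` T))"
    using assms by (intro card_image_le finite_cartesian_product finite_bounded_subsets) auto
  also have "\<dots> = card (?F M) * (card T + 1)"
    using assms by (simp add: card_cartesian_product card_image)
  also have "\<dots> \<le> (card T + 1) ^ M * (card T + 1)"
    using Suc by (rule mult_right_mono) simp
  finally show ?case by (simp add: mult.commute)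
qed

lemma arith_prog_nonempty: "arith_prog S d \<Longrightarrow> S \<noteq> {}"
  by (auto simp: arith_prog_def lessThan_empty_iff)

lemma arith_progs_below:
  fixes H :: nat
  defines "\<A> \<equiv> {S. S \<subseteq> {..<H} \<and> (\<exists>d. arith_prog S d)}"
  shows "finite \<A>" and "card \<A> \<le> (H + 1) ^ 3"
proof -
  show "finite \<A>"
    unfolding \<A>_def by (rule finite_subset[of _ "Pow {..<H}"]) auto
  let ?c = "\<lambda>(a, d, m). (\<lambda>i::nat. a + d * i) ` {..<m::nat}"
  have "\<A> \<subseteq> ?c ` ({..H} \<times> {..H} \<times> {..H})"
  proof
    fix S assume "S \<in> \<A>"
    then obtain d a m where S: "S \<subseteq> {..<H}" "1 \<le> d" "1 \<le> m" "S = (\<lambda>i. a + d * i) ` {..<m}"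
      by (auto simp: \<A>_def arith_prog_def)
    have el: "a + d * i < H" if "i < m" for i
      using S(1,4) that by auto
    have "a < H" using el[of 0] S(3) by simp
    show "S \<in> ?c ` ({..H} \<times> {..H} \<times> {..H})"
    \<comment> \<open>A one-term progression admits arbitrarily large steps, so it is recoded with
      step 1; from two terms on, the step is bounded by \<open>H\<close>.\<close>
    proof (cases "m = 1")
      case True
      then show ?thesis
        using S(4) \<open>a < H\<close> by (intro image_eqI[of _ _ "(a, 1, 1)"]) (auto simp: lessThan_Suc)
    next
      case False
      have "a + d * (m - 1) < H" using el[of "m - 1"] S(3) by simp
      moreover have "d * 1 \<le> d * (m - 1)" "1 * (m - 1) \<le> d * (m - 1)"
        using False S(2,3) by (intro mult_le_mono; simp)+
      ultimately have "d \<le> H" "m \<le> H" using S(3) by linarith+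
      then show ?thesis
        using S(4) \<open>a < H\<close> by (intro image_eqI[of _ _ "(a, d, m)"]) auto
    qed
  qed
  then have "card \<A> \<le> card (?c ` ({..H} \<times> {..H} \<times> {..H}))"
    by (intro card_mono) auto
  also have "\<dots> \<le> card ({..H} \<times> {..H} \<times> {..H})"
    by (intro card_image_le) auto
  also have "\<dots> = (H + 1) ^ 3"
    by (simp add: card_cartesian_product power3_eq_cube)
  finally show "card \<A> \<le> (H + 1) ^ 3" .
qed

text \<open>The blocks need not cover \<open>{..<H}\<close>: with 0 as default value, sparse
  functions and functions constant on the blocks of a partition share one encoding.\<close>

definition const_on_few_progressions :: "nat \<Rightarrow> nat \<Rightarrow> (nat \<Rightarrow> int) \<Rightarrow> bool" where
  "const_on_few_progressions H M e \<longleftrightarrow>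
    (\<exists>P. finite P \<and> card P \<le> M \<and> disjoint P \<and> (\<forall>S\<in>P. S \<subseteq> {..<H} \<and> (\<exists>d. arith_prog S d)) \<and>
      (\<forall>S\<in>P. \<forall>h\<in>S. \<forall>h'\<in>S. e h = e h') \<and> (\<forall>h. h \<notin> \<Union>P \<longrightarrow> e h = 0))"

text \<open>Such a function is recovered from at most \<open>M\<close> pairs of a block and its
  value, and at most \<open>3 * (H + 1) ^ 3\<close> pairs are possible.\<close>

lemma const_on_few_progressions_finite_card:
  fixes H M :: nat
  defines "\<E> \<equiv> {e. const_on_few_progressions H M e \<and> (\<forall>h. e h \<in> {-1, 0, 1})}"
  shows "finite \<E>" and "card \<E> \<le> (3 * (H + 1) ^ 3 + 1) ^ M"
proof -
  define \<A> where "\<A> = {S. S \<subseteq> {..<H} \<and> (\<exists>d. arith_prog S d)}"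
  define T where "T = \<A> \<times> {-1, 0, 1::int}"
  \<comment> \<open>Decoding adds the values of all blocks containing \<open>h\<close>. The blocks
    being disjoint, at most one contributes, and no block at all gives the default 0.\<close>
  define dec where "dec U = (\<lambda>h. \<Sum>(S, v)\<in>U. if h \<in> S then v else 0)" for U :: "(nat set \<times> int) set"
  have "finite T"
    unfolding T_def \<A>_def using arith_progs_below(1)[of H] by (intro finite_cartesian_product) simp_all
  have "card T = card \<A> * 3"
    by (simp add: T_def card_cartesian_product)
  then have cT: "card T \<le> 3 * (H + 1) ^ 3"
    using arith_progs_below(2)[of H] unfolding \<A>_def[symmetric] by simp
  have sub: "\<E> \<subseteq> dec ` {U. U \<subseteq> T \<and> card U \<le> M}"
  proof
    fix e assume "e \<in> \<E>"
    then have few: "const_on_few_progressions H M e" and e: "\<forall>h. e h \<in> {-1, 0, 1}"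
      by (simp_all add: \<E>_def)
    from few obtain P where P: "finite P" "card P \<le> M" "disjoint P"
      "\<forall>S\<in>P. S \<subseteq> {..<H} \<and> (\<exists>d. arith_prog S d)"
      "\<forall>S\<in>P. \<forall>h\<in>S. \<forall>h'\<in>S. e h = e h'" "\<forall>h. h \<notin> \<Union>P \<longrightarrow> e h = 0"
      unfolding const_on_few_progressions_def by (elim exE conjE) (rule that)
    define U where "U = (\<lambda>S. (S, e (Min S))) ` P"
    have fin: "finite S" "S \<noteq> {}" if "S \<in> P" for S
      using P(4) that finite_subset[of S "{..<H}"] arith_prog_nonempty by auto
    have val: "e (Min S) = e h" if "S \<in> P" "h \<in> S" for S h
      using P(5) that fin[of S] Min_in[of S] by blast
    have "inj_on (\<lambda>S. (S, e (Min S))) P" by (auto simp: inj_on_def)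
    have "dec U = e"
    proof
      fix h
      have "dec U h = (\<Sum>S\<in>P. if h \<in> S then e (Min S) else 0)"
        unfolding dec_def U_def by (subst sum.reindex[OF \<open>inj_on _ P\<close>]) (simp add: o_def)
      also have "\<dots> = e h"
      proof (cases "h \<in> \<Union>P")
        case True
        then obtain S0 where S0: "S0 \<in> P" "h \<in> S0" by blast
        have "(\<Sum>S\<in>P. if h \<in> S then e (Min S) else 0) = (\<Sum>S\<in>P. if S = S0 then e h else 0)"
        proof (rule sum.cong)
          fix S assume S: "S \<in> P"
          have "h \<notin> S" if "S \<noteq> S0"
            using P(3) S S0 that by (auto simp: disjoint_def)
          then show "(if h \<in> S then e (Min S) else 0) = (if S = S0 then e h else 0)"
            using val[OF S0] S0 by auto
        qed simp
        then show ?thesis using S0 P(1) by simp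
      next
        case False
        then have "(\<Sum>S\<in>P. if h \<in> S then e (Min S) else 0) = 0"
          by (intro sum.neutral) auto
        then show ?thesis using False P(6) by simp
      qed
      finally show "dec U h = e h" .
    qed
    moreover have "U \<subseteq> T"
      using P(4) e by (auto simp: U_def T_def \<A>_def)
    moreover have "card U \<le> M"
      using P(1,2) card_image_le[of P "\<lambda>S. (S, e (Min S))"] by (simp add: U_def)
    ultimately show "e \<in> dec ` {U. U \<subseteq> T \<and> card U \<le> M}" by blast
  qed
  have fin: "finite (dec ` {U. U \<subseteq> T \<and> card U \<le> M})"
    using finite_bounded_subsets[OF \<open>finite T\<close>] by (rule finite_imageI)
  show "finite \<E>"
    using sub fin by (rule finite_subset)
  have "card \<E> \<le> card (dec ` {U. U \<subseteq> T \<and> card U \<le> M})"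
    using sub fin by (intro card_mono)
  also have "\<dots> \<le> card {U. U \<subseteq> T \<and> card U \<le> M}"
    using finite_bounded_subsets[OF \<open>finite T\<close>] by (rule card_image_le)
  also have "\<dots> \<le> (card T + 1) ^ M"
    by (rule card_bounded_subsets_le[OF \<open>finite T\<close>])
  also have "\<dots> \<le> (3 * (H + 1) ^ 3 + 1) ^ M"
    using cT by (intro power_mono) auto
  finally show "card \<E> \<le> (3 * (H + 1) ^ 3 + 1) ^ M" .
qed

text \<open>A sparse function is constant on the singletons of its support, so both structured
  alternatives fall under the same count.\<close>

lemma const_on_few_progressions_sparse:
  assumes "\<And>h. e h \<noteq> 0 \<Longrightarrow> h < H" and "card {h. e h \<noteq> 0} \<le> M"
  shows "const_on_few_progressions H M e"
proof -
  define P where "P = (\<lambda>h. {h}) ` {h. e h \<noteq> 0}"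
  have "finite {h. e h \<noteq> 0}"
    using assms(1) by (auto intro: finite_subset[of _ "{..<H}"])
  then have "finite P" "card P \<le> M"
    using assms(2) card_image_le[of "{h. e h \<noteq> 0}" "\<lambda>h. {h}"] by (auto simp: P_def)
  moreover have "arith_prog {h} 1" for h
  proof -
    have "{h} = (\<lambda>i. h + 1 * i) ` {..<1}" by (simp add: lessThan_Suc)
    then show ?thesis unfolding arith_prog_def by blast
  qed
  ultimately show ?thesis
    unfolding const_on_few_progressions_def
    by (intro exI[of _ P]) (use assms(1) in \<open>auto simp: P_def disjoint_def\<close>)
qed

lemma const_on_few_progressions_partition:
  assumes "partition_on {..<H} P" "finite P" "card P \<le> M"
    and "\<And>S. S \<in> P \<Longrightarrow> \<exists>d. arith_prog S d"
    and "\<And>S h h'. S \<in> P \<Longrightarrow> h \<in> S \<Longrightarrow> h' \<in> S \<Longrightarrow> e h = e h'" and "\<And>h. \<not> h < H \<Longrightarrow> e h = 0"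
  shows "const_on_few_progressions H M e"
  unfolding const_on_few_progressions_def
proof (intro exI[of _ P] conjI ballI allI impI)
  fix S assume "S \<in> P"
  then show "S \<subseteq> {..<H}" using partition_onD1[OF assms(1)] by blast
next
  fix h assume "h \<notin> \<Union>P"
  then show "e h = 0" using partition_onD1[OF assms(1)] assms(6) by auto
qed (fact assms | (rule partition_onD2, fact assms) | (erule (2) assms) | (erule assms))+

section \<open>Structure of the error function\<close>

text \<open>This makes divisibility of \<open>Z h\<close> by \<open>q\<close> depend only on
  \<open>h\<close> modulo \<open>q\<close>.\<close>

lemma diff_dvd_poly_diff:
  fixes Z :: "'a::comm_ring_1 poly"
  shows "x - y dvd poly Z x - poly Z y"
proof (induction Z)
  case 0
  then show ?case by simp
next
  case (pCons a p)
  have "poly (pCons a p) x - poly (pCons a p) y = x * (poly p x - poly p y) + (x - y) * poly p y"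
    by (simp add: algebra_simps)
  then show ?case using pCons.IH by simp
qed

lemma has_real_derivative_higher_pderiv:
  "(poly ((pderiv ^^ j) p) has_real_derivative poly ((pderiv ^^ Suc j) p) y) (at y)"
  using poly_DERIV[of "(pderiv ^^ j) p" y] by simp

lemma higher_pderiv_eq_0:
  fixes p :: "real poly"
  assumes "degree p < l"
  shows "(pderiv ^^ l) p = 0"
proof (rule poly_eqI)
  fix n
  have "coeff p (n + l) = 0"
    using assms by (intro coeff_eq_0) simp
  then show "coeff ((pderiv ^^ l) p) n = coeff 0 n"
    by (simp add: coeff_higher_pderiv add.commute)
qed

text \<open>With \<open>q * P = Z + S\<close> and \<open>\<bar>S\<bar> < 1/2\<close>, both floors in \<open>err\<close> equal \<open>Z h div q\<close>, except that when \<open>q\<close>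
  divides \<open>Z h\<close> they may drop by one according to the signs of \<open>P - Z/q\<close> and \<open>f - Z/q\<close>. The \<open>l\<close>-th
  derivatives of these two functions are \<open>0\<close> and \<open>D l\<close>, so the signs are governed by few intervals.\<close>

lemma structure_of_err:
  fixes f :: "real \<Rightarrow> real" and D :: "nat \<Rightarrow> real \<Rightarrow> real" and L \<epsilon> :: real
  assumes D: "\<forall>t\<ge>1. D 0 t = f t" "\<forall>j. \<forall>t>1. (D j has_real_derivative D (Suc j) t) (at t)"
    and "1 < N" "1 \<le> l"
    and sgn: "(\<forall>t\<ge>real N. D l t < 0) \<or> (\<forall>t\<ge>real N. 0 \<le> D l t)"
    and close: "\<And>y. 0 \<le> y \<Longrightarrow> y \<le> real H \<Longrightarrow> \<bar>f (real N + y) - taylor_poly D l N y\<bar> \<le> \<epsilon>" and "\<epsilon> > 0"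
    and L: "1 \<le> L" "L \<le> real H"
    and small: "l * (6 * L) ^ (l - 1) * ((4 * L) ^ (l * (l - 1)) * \<epsilon>) < 1 / 2"
    and dense: "l * real H \<le> L * card {h. h < H \<and> err f D l N h \<noteq> 0}"
  shows "\<exists>q P. 1 \<le> q \<and> real q \<le> (4 * L) ^ (l * (l - 1)) \<and> partition_on {..<H} P \<and> finite P \<and>
    card P \<le> q * 4 ^ l \<and> (\<forall>S\<in>P. arith_prog S q) \<and>
    (\<forall>S\<in>P. \<forall>h\<in>S. \<forall>h'\<in>S. err f D l N h = err f D l N h')"
proof -
  define P where "P = (\<Sum>j<l. monom (D j N / fact j) j)"
  have degP: "degree P < l"
    unfolding P_def using \<open>1 \<le> l\<close> by (intro degree_sum_less) (auto intro: le_less_trans[OF degree_monom_le])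
  have polyP: "poly P y = taylor_poly D l N y" for y
    by (simp add: P_def poly_sum poly_monom taylor_poly_def mult.commute)
  define Eh where "Eh = {h. h < H \<and> err f D l N h \<noteq> 0}"
  \<comment> \<open>If the two floors differ, the larger one is an integer between the values of
    \<open>P\<close> and \<open>f\<close>, hence within \<open>\<epsilon>\<close> of
    \<open>P\<close>.\<close>
  define m where "m x = max \<lfloor>f (real N + real_of_int x)\<rfloor> \<lfloor>poly P (real_of_int x)\<rfloor>" for x :: int
  have hit: "\<bar>poly P (real_of_int x) - real_of_int (m x)\<bar> \<le> \<epsilon>" if x: "x \<in> int ` Eh" for x
  proof -
    obtain h where h: "x = int h" "h < H" "err f D l N h \<noteq> 0"
      using x by (auto simp: Eh_def)
    define u v where "u = f (real N + real h)" and "v = poly P (real h)"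
    have "\<bar>u - v\<bar> \<le> \<epsilon>"
      using close[of "real h"] h(2) by (simp add: u_def v_def polyP)
    moreover have "\<lfloor>u\<rfloor> \<noteq> \<lfloor>v\<rfloor>"
      using h(3) by (simp add: err_def u_def v_def polyP)
    moreover have "m x = max \<lfloor>u\<rfloor> \<lfloor>v\<rfloor>"
      by (simp add: m_def u_def v_def h(1))
    moreover have "poly P (real_of_int x) = v" by (simp add: v_def h(1))
    ultimately show ?thesis by linarith
  qed
  have EH: "int ` Eh \<subseteq> {0..<int H}" by (auto simp: Eh_def)
  have "card (int ` Eh) = card Eh" by (simp add: card_image)
  then have dense': "l * real H \<le> L * card (int ` Eh)"
    using dense by (simp add: Eh_def)
  obtain q' :: int and Z where q': "1 \<le> q'" "q' \<le> (4 * L) ^ (l * (l - 1))" "q' * \<epsilon> < 1 / 2"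
    and Z: "degree Z < l"
      "\<forall>y. 0 \<le> y \<and> y \<le> real H \<longrightarrow> \<bar>q' * poly P y - poly (map_poly of_int Z) y\<bar> < 1 / 2"
    using dense_hits_imp_rational_curve[OF degP L(1) hit \<open>\<epsilon> > 0\<close> small EH L(2) dense'] by blast
  define q where "q = nat q'"
  have q: "q' = int q" "1 \<le> q" using q'(1) by (auto simp: q_def)
  define R where "R = smult (1 / real q) (map_poly real_of_int Z)"
  have degR: "degree R < l"
    unfolding R_def using Z(1) degree_map_poly_of_int_le[of Z, where 'a = real] degree_smult_le
    by (metis le_less_trans)
  define G1 where "G1 j y = poly ((pderiv ^^ j) (P - R)) y" for j y
  define G2 where "G2 j y = D j (real N + y) - poly ((pderiv ^^ j) R) y" for j y
  have "\<exists>\<phi>::real \<Rightarrow> nat. (\<forall>y. \<phi> y < 2 ^ l) \<and>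
    (\<forall>x\<in>{0..real H}. \<forall>y\<in>{0..real H}. \<forall>z\<in>{0..real H}. x \<le> y \<longrightarrow> y \<le> z \<longrightarrow> \<phi> x = \<phi> z \<longrightarrow> \<phi> y = \<phi> x) \<and>
    (\<forall>x\<in>{0..real H}. \<forall>y\<in>{0..real H}. \<phi> x = \<phi> y \<longrightarrow> (G1 0 x < 0 \<longleftrightarrow> G1 0 y < 0))"
  proof (rule exists_sign_labelling)
    show "(G1 j has_real_derivative G1 (Suc j) y) (at y)" for j y
      unfolding G1_def by (rule has_real_derivative_higher_pderiv)
    have "degree (P - R) < l" using degP degR by (rule degree_diff_less)
    then have "G1 l y = 0" for y unfolding G1_def by (simp add: higher_pderiv_eq_0)
    then show "(\<forall>y\<in>{0..real H}. G1 l y < 0) \<or> (\<forall>y\<in>{0..real H}. 0 \<le> G1 l y)" by simp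
  qed
  then obtain \<phi>1 :: "real \<Rightarrow> nat" where \<phi>1: "\<And>y. \<phi>1 y < 2 ^ l"
    "\<And>x y z. x \<in> {0..real H} \<Longrightarrow> y \<in> {0..real H} \<Longrightarrow> z \<in> {0..real H} \<Longrightarrow>
      x \<le> y \<Longrightarrow> y \<le> z \<Longrightarrow> \<phi>1 x = \<phi>1 z \<Longrightarrow> \<phi>1 y = \<phi>1 x"
    "\<And>x y. x \<in> {0..real H} \<Longrightarrow> y \<in> {0..real H} \<Longrightarrow> \<phi>1 x = \<phi>1 y \<Longrightarrow> (G1 0 x < 0 \<longleftrightarrow> G1 0 y < 0)"
    by blast
  have "\<exists>\<phi>::real \<Rightarrow> nat. (\<forall>y. \<phi> y < 2 ^ l) \<and>
    (\<forall>x\<in>{0..real H}. \<forall>y\<in>{0..real H}. \<forall>z\<in>{0..real H}. x \<le> y \<longrightarrow> y \<le> z \<longrightarrow> \<phi> x = \<phi> z \<longrightarrow> \<phi> y = \<phi> x) \<and>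
    (\<forall>x\<in>{0..real H}. \<forall>y\<in>{0..real H}. \<phi> x = \<phi> y \<longrightarrow> (G2 0 x < 0 \<longleftrightarrow> G2 0 y < 0))"
  proof (rule exists_sign_labelling)
    show "(G2 j has_real_derivative G2 (Suc j) y) (at y)" if "0 \<le> y" for j y
    proof -
      have "(D j has_real_derivative D (Suc j) (real N + y)) (at (real N + y))"
        using D(2) \<open>1 < N\<close> that by auto
      then have "((\<lambda>t. D j (real N + t)) has_real_derivative D (Suc j) (real N + y)) (at y)"
        using DERIV_shift[of "D j" "D (Suc j) (real N + y)" y "real N"] by (simp add: add.commute)
      then show ?thesis
        unfolding G2_def by (intro DERIV_diff has_real_derivative_higher_pderiv)
    qed
    have G2l: "G2 l y = D l (real N + y)" for y
      unfolding G2_def by (simp add: higher_pderiv_eq_0[OF degR])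
    from sgn show "(\<forall>y\<in>{0..real H}. G2 l y < 0) \<or> (\<forall>y\<in>{0..real H}. 0 \<le> G2 l y)"
    proof
      assume "\<forall>t\<ge>real N. D l t < 0"
      then show ?thesis by (intro disjI1 ballI) (simp add: G2l)
    next
      assume "\<forall>t\<ge>real N. 0 \<le> D l t"
      then show ?thesis by (intro disjI2 ballI) (simp add: G2l)
    qed
  qed
  then obtain \<phi>2 :: "real \<Rightarrow> nat" where \<phi>2: "\<And>y. \<phi>2 y < 2 ^ l"
    "\<And>x y z. x \<in> {0..real H} \<Longrightarrow> y \<in> {0..real H} \<Longrightarrow> z \<in> {0..real H} \<Longrightarrow>
      x \<le> y \<Longrightarrow> y \<le> z \<Longrightarrow> \<phi>2 x = \<phi>2 z \<Longrightarrow> \<phi>2 y = \<phi>2 x"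
    "\<And>x y. x \<in> {0..real H} \<Longrightarrow> y \<in> {0..real H} \<Longrightarrow> \<phi>2 x = \<phi>2 y \<Longrightarrow> (G2 0 x < 0 \<longleftrightarrow> G2 0 y < 0)"
    by blast
  \<comment> \<open>Pairing the labels keeps their level sets intervals and gives
    \<open>2 ^ l * 2 ^ l = 4 ^ l\<close> values.\<close>
  define \<psi> where "\<psi> h = (\<phi>1 (real h), \<phi>2 (real h))" for h :: nat
  define C where "C = {..<(2::nat) ^ l} \<times> {..<(2::nat) ^ l}"
  have cardC: "card C = 4 ^ l"
    by (simp add: C_def card_cartesian_product power_mult_distrib[symmetric])
  \<comment> \<open>The common term \<open>z div q\<close> cancels. The distance of
    \<open>q * P\<close> from \<open>z\<close> is below \<open>1/2\<close>, and
    \<open>q * \<epsilon> < 1/2\<close> keeps \<open>q * f\<close> within 1 of \<open>z\<close>, as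
    the floor formula requires.\<close>
  have err_eq: "err f D l N h = (if int q dvd poly Z (int h) \<and> G1 0 (real h) < 0 then 1 else 0)
      - (if int q dvd poly Z (int h) \<and> G2 0 (real h) < 0 then 1 else 0)" if h: "h < H" for h
  proof -
    define z where "z = poly Z (int h)"
    have zr: "poly (map_poly real_of_int Z) (real h) = real_of_int z"
      unfolding z_def using poly_map_poly_of_int[of Z "int h", where 'a = real] by simp
    have Pz: "\<bar>int q * poly P (real h) - z\<bar> < 1 / 2"
      using Z(2)[rule_format, of "real h"] h q(1) zr by simp
    have "\<bar>f (real N + real h) - poly P (real h)\<bar> \<le> \<epsilon>"
      using close[of "real h"] h by (simp add: polyP)
    then have "real q * \<bar>f (real N + real h) - poly P (real h)\<bar> \<le> q * \<epsilon>"
      by (rule mult_left_mono) simp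
    then have "\<bar>real q * f (real N + real h) - real q * poly P (real h)\<bar> < 1 / 2"
      using q'(3) q(1) by (simp add: right_diff_distrib[symmetric] abs_mult)
    with Pz have fz: "\<bar>int q * f (real N + real h) - z\<bar> < 1"
      by (simp only: of_int_of_nat_eq)
    have "\<lfloor>poly P (real h)\<rfloor> = z div q - (if int q dvd z \<and> poly P (real h) < z / int q then 1 else 0)"
      using Pz q(2) by (intro floor_near_rational) auto
    moreover have "\<lfloor>f (real N + real h)\<rfloor> = z div q - (if int q dvd z \<and> f (real N + real h) < z / int q then 1 else 0)"
      using fz q(2) by (intro floor_near_rational) auto
    moreover have "poly R (real h) = z / int q"
      by (simp add: R_def zr)
    moreover have "D 0 (real N + real h) = f (real N + real h)"
      using D(1) \<open>1 < N\<close> by simp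
    ultimately show ?thesis
      unfolding err_def G1_def G2_def z_def[symmetric] by (simp add: polyP)
  qed
  have "\<exists>P. partition_on {..<H} P \<and> finite P \<and> card P \<le> q * card C \<and>
    (\<forall>S\<in>P. arith_prog S q) \<and> (\<forall>S\<in>P. \<forall>h\<in>S. \<forall>h'\<in>S. err f D l N h = err f D l N h')"
  proof (rule partition_by_residue_and_label)
    show "\<psi> h \<in> C" for h
      using \<phi>1(1) \<phi>2(1) by (simp add: \<psi>_def C_def)
    show "\<psi> y = \<psi> x" if "x \<le> y" "y \<le> z" "z < H" "\<psi> x = \<psi> z" for x y z
      using that \<phi>1(2)[of x y z] \<phi>2(2)[of x y z] by (simp add: \<psi>_def)
    show "err f D l N x = err f D l N y"
      if "x < H" "y < H" "x mod q = y mod q" "\<psi> x = \<psi> y" for x y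
    proof -
      have "int x mod int q = int y mod int q"
        using that(3) by (simp flip: of_nat_mod)
      then have "int q dvd int x - int y" by (simp add: mod_eq_dvd_iff)
      then have "int q dvd poly Z (int x) - poly Z (int y)"
        using diff_dvd_poly_diff dvd_trans by blast
      then have "int q dvd poly Z (int x) \<longleftrightarrow> int q dvd poly Z (int y)"
        using dvd_diff_right_iff dvd_diff_left_iff by blast
      moreover have "G1 0 (real x) < 0 \<longleftrightarrow> G1 0 (real y) < 0"
        using that \<phi>1(3)[of x y] by (simp add: \<psi>_def)
      moreover have "G2 0 (real x) < 0 \<longleftrightarrow> G2 0 (real y) < 0"
        using that \<phi>2(3)[of x y] by (simp add: \<psi>_def)
      ultimately show ?thesis
        unfolding err_eq[OF that(1)] err_eq[OF that(2)] by simp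
    qed
  qed (use q in \<open>auto simp: C_def\<close>)
  then show ?thesis
    using q q'(2) unfolding cardC by auto
qed

text \<open>Here \<open>L = H powr \<delta>\<close> is the inverse density of the nonzero values of \<open>err\<close>, and \<open>\<delta>\<close> is such that
  the powers of \<open>L\<close> lost above, of exponent at most \<open>l\<^sup>2\<close>, stay below \<open>H powr (1/2)\<close>.\<close>

lemma err_trichotomy:
  fixes f :: "real \<Rightarrow> real" and D :: "nat \<Rightarrow> real \<Rightarrow> real" and k l :: nat
  defines "\<delta> \<equiv> 1 / (2 * (real l + 1)\<^sup>2) :: real"
  assumes "k < l" and "in_hardy f"
    and growth: "\<exists>C>0. \<forall>\<^sub>F t in at_top. \<bar>f t\<bar> \<le> C * t ^ k"
    and D0: "\<forall>t\<ge>1. D 0 t = f t"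
    and D: "\<forall>j. \<forall>t\<ge>1. (D j has_real_derivative D (Suc j) t) (at t within {1..})"
  shows "\<exists>C\<ge>1. \<forall>H N. 1 \<le> H \<longrightarrow>
    real N \<le> C * real H powr ((real l + (1 - \<delta> / 2)) / (real l - real k)) \<or>
    (\<forall>h<H. err f D l N h \<in> {-1, 0, 1}) \<and>
    (real (card {h. h < H \<and> err f D l N h \<noteq> 0}) \<le> C * real H powr (1 - \<delta>) \<or>
     (\<exists>P. partition_on {..<H} P \<and> finite P \<and> real (card P) \<le> C * real H powr (1 - \<delta>) \<and>
        (\<forall>S\<in>P. \<exists>d. arith_prog S d \<and> real d \<le> C * real H powr (1 - \<delta>)) \<and>
        (\<forall>S\<in>P. \<forall>h\<in>S. \<forall>h'\<in>S. err f D l N h = err f D l N h')))"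
proof -
  have "1 \<le> l" using \<open>k < l\<close> by simp
  have \<delta>: "0 < \<delta>" "\<delta> \<le> 1 / 2" "\<delta> * (real l)\<^sup>2 \<le> 1 / 2"
  proof -
    have "1 \<le> (real l + 1)\<^sup>2" "(real l)\<^sup>2 \<le> (real l + 1)\<^sup>2" by simp_all
    then show "0 < \<delta>" "\<delta> \<le> 1 / 2" "\<delta> * (real l)\<^sup>2 \<le> 1 / 2"
      unfolding \<delta>_def by (auto simp: divide_simps)
  qed
  note D' = derivs_at_of_derivs_within[OF D]
  obtain C0 where C0: "C0 > 0" "\<forall>\<^sub>F t in at_top. \<bar>f t\<bar> \<le> C0 * t ^ k"
    using growth by blast
  obtain T1 where T1: "(\<forall>t\<ge>T1. D l t < 0) \<or> (\<forall>t\<ge>T1. 0 \<le> D l t)"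
    using hardy_derivs_sign_and_growth(1)[OF \<open>in_hardy f\<close> C0 D0 D, of l]
    unfolding eventually_at_top_linorder by blast
  obtain C1 T2 where C1: "C1 > 0" and T2: "\<And>t. t \<ge> T2 \<Longrightarrow> \<bar>D l t\<bar> \<le> C1 * t powr (real k - real l)"
    using hardy_derivs_sign_and_growth(2)[OF \<open>in_hardy f\<close> C0 D0 D, of l]
    unfolding eventually_at_top_linorder by blast
  define K :: real where "K = l * 6 ^ (l - 1) * 4 ^ (l * (l - 1))"
  \<comment> \<open>\<open>T1\<close> and \<open>T2\<close> place every \<open>N > C\<close> where
    sign and decay of \<open>D l\<close> hold; \<open>C1\<close> yields
    \<open>\<epsilon> < 1\<close>; \<open>2 * K * C1\<close> yields the smallness condition;
    \<open>l\<close> turns failure of sparsity into density; the last summand bounds step and number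
    of the progressions.\<close>
  define C where "C = 1 + \<bar>T1\<bar> + \<bar>T2\<bar> + C1 + 2 * K * C1 + l + 4 ^ (l * (l - 1)) * 4 ^ l"
  have "K \<ge> 0" by (simp add: K_def)
  then have "K * C1 \<ge> 0" using C1 by simp
  have big: "(0::real) \<le> 4 ^ (l * (l - 1)) * 4 ^ l" "(4::real) ^ (l * (l - 1)) \<le> 4 ^ (l * (l - 1)) * 4 ^ l"
    by simp_all
  have C: "1 \<le> C" "T1 \<le> C" "T2 \<le> C" "C1 < C" "2 * K * C1 < C" "l \<le> C"
      "4 ^ (l * (l - 1)) * 4 ^ l \<le> C" "4 ^ (l * (l - 1)) \<le> C"
    using C1 \<open>K * C1 \<ge> 0\<close> big unfolding C_def by linarith+
  show ?thesis
  proof (intro exI[of _ C] conjI allI impI)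
    fix H N :: nat
    assume "1 \<le> H"
    then have H: "1 \<le> real H" by simp
    define \<eta> where "\<eta> = 1 - \<delta> / 2"
    define E where "E = {h. h < H \<and> err f D l N h \<noteq> 0}"
    define L where "L = real H powr \<delta>"
    have L: "1 \<le> L" "L \<le> real H"
      using H \<delta> powr_mono[of \<delta> 1 "real H"] by (auto simp: L_def ge_one_powr_ge_zero)
    show "real N \<le> C * real H powr ((real l + (1 - \<delta> / 2)) / (real l - real k)) \<or>
      (\<forall>h<H. err f D l N h \<in> {-1, 0, 1}) \<and>
      (real (card {h. h < H \<and> err f D l N h \<noteq> 0}) \<le> C * real H powr (1 - \<delta>) \<or>
       (\<exists>P. partition_on {..<H} P \<and> finite P \<and> real (card P) \<le> C * real H powr (1 - \<delta>) \<and>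
          (\<forall>S\<in>P. \<exists>d. arith_prog S d \<and> real d \<le> C * real H powr (1 - \<delta>)) \<and>
          (\<forall>S\<in>P. \<forall>h\<in>S. \<forall>h'\<in>S. err f D l N h = err f D l N h')))"
    proof (cases "real N \<le> C * real H powr ((real l + \<eta>) / (real l - real k))")
      case True
      then show ?thesis unfolding \<eta>_def by blast
    next
      case False
      have lk: "1 \<le> real l - real k" using \<open>k < l\<close> by linarith
      have "0 \<le> \<eta>" "1 / 2 \<le> \<eta>" using \<delta> by (auto simp: \<eta>_def)
      have "1 \<le> real H powr ((real l + \<eta>) / (real l - real k))"
        using H lk \<open>0 \<le> \<eta>\<close> by (intro ge_one_powr_ge_zero) auto
      then have "C * 1 \<le> C * real H powr ((real l + \<eta>) / (real l - real k))"
        using C(1) by (intro mult_left_mono) auto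
      then have NC: "C < real N" using False by linarith
      then have "1 < N" using C(1) by linarith
      \<comment> \<open>Failure of (A) is raised to the power \<open>l - k\<close>; since this is at
        least 1 and \<open>C \<ge> 1\<close>, one factor \<open>C\<close> may be kept in place of
        its power.\<close>
      have "(C * real H powr ((real l + \<eta>) / (real l - real k))) powr (real l - real k)
          \<le> real N powr (real l - real k)"
        using False C(1) lk by (intro powr_mono2) auto
      moreover have "(C * real H powr ((real l + \<eta>) / (real l - real k))) powr (real l - real k)
          = C powr (real l - real k) * real H powr (real l + \<eta>)"
        using C(1) lk by (simp add: powr_mult powr_powr)
      moreover have "C powr 1 \<le> C powr (real l - real k)"
        using C(1) lk by (intro powr_mono) auto
      then have "C * real H powr (real l + \<eta>) \<le> C powr (real l - real k) * real H powr (real l + \<eta>)"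
        using C(1) by (intro mult_right_mono) auto
      ultimately have N: "C * real H powr (real l + \<eta>) \<le> real N powr (real l - real k)" by linarith
      \<comment> \<open>The Taylor remainder is at most \<open>C1 * N powr (k - l) * H ^ l\<close>,
        and the lower bound on \<open>N\<close> just obtained turns this into
        \<open>\<epsilon>\<close>.\<close>
      define \<epsilon> where "\<epsilon> = C1 / C * real H powr (- \<eta>)"
      have "\<epsilon> > 0" using C1 C(1) H by (simp add: \<epsilon>_def)
      have "real N powr (real k - real l) = 1 / real N powr (real l - real k)"
        by (simp add: powr_minus_divide[symmetric])
      also have "\<dots> \<le> 1 / (C * real H powr (real l + \<eta>))"
        using N C(1) H \<open>1 < N\<close> by (intro divide_left_mono) (auto intro!: mult_pos_pos)
      finally have "C1 * real N powr (real k - real l) * real H ^ l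
          \<le> C1 * (1 / (C * real H powr (real l + \<eta>))) * real H ^ l"
        using C1 by (intro mult_right_mono mult_left_mono) auto
      also have "\<dots> = \<epsilon>"
        using H C(1) by (simp add: \<epsilon>_def powr_add powr_minus powr_realpow field_simps)
      finally have \<epsilon>: "C1 * real N powr (real k - real l) * real H ^ l \<le> \<epsilon>" .
      have close: "\<bar>f (real N + y) - taylor_poly D l N y\<bar> \<le> \<epsilon>" if y: "0 \<le> y" "y \<le> real H" for y
      proof -
        have "\<bar>D l t\<bar> \<le> C1 * real N powr (real k - real l)" if "real N \<le> t" for t
        proof -
          have "\<bar>D l t\<bar> \<le> C1 * t powr (real k - real l)"
            using T2 that NC C(3) by simp
          also have "\<dots> \<le> C1 * real N powr (real k - real l)"
            using that lk C1 \<open>1 < N\<close> by (intro mult_left_mono powr_mono2') auto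
          finally show ?thesis .
        qed
        then have "\<bar>f (real N + y) - taylor_poly D l N y\<bar> \<le> C1 * real N powr (real k - real l) * y ^ l"
          by (intro taylor_remainder_bound[OF D0 D' \<open>1 < N\<close> y(1)])
        also have "\<dots> \<le> C1 * real N powr (real k - real l) * real H ^ l"
          using y C1 by (intro mult_left_mono power_mono) auto
        finally show ?thesis using \<epsilon> by linarith
      qed
      have "real H powr (- \<eta>) \<le> real H powr 0"
        using H \<open>0 \<le> \<eta>\<close> by (intro powr_mono) auto
      then have "C1 / C * real H powr (- \<eta>) \<le> C1 / C * 1"
        using C1 C(1) H by (intro mult_left_mono) auto
      moreover have "C1 / C < 1" using C by (simp add: divide_less_eq)
      ultimately have "\<epsilon> < 1" by (simp add: \<epsilon>_def)
      have vals: "err f D l N h \<in> {-1, 0, 1}" if "h < H" for h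
      proof -
        have "\<bar>f (real N + real h) - taylor_poly D l N (real h)\<bar> < 1"
          using close[of "real h"] that \<open>\<epsilon> < 1\<close> by simp
        then have "err f D l N h \<in> {-1..1}"
          unfolding err_def by (simp add: abs_less_iff) linarith
        then show ?thesis by auto
      qed
      have Lpow: "L ^ n \<le> real H powr (1 / 2)" if "n \<le> l ^ 2" for n
      proof -
        have "\<delta> * n \<le> \<delta> * (real l)\<^sup>2"
          using that \<delta>(1) by (intro mult_left_mono) (auto simp flip: of_nat_power)
        then have "real H powr (\<delta> * n) \<le> real H powr (1 / 2)"
          using H \<delta>(3) by (intro powr_mono) auto
        then show ?thesis
          using H by (simp add: L_def powr_powr flip: powr_realpow)
      qed
      show ?thesis
      proof (cases "card E \<le> C * real H powr (1 - \<delta>)")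
        case True
        then show ?thesis using vals unfolding E_def by blast
      next
        case dense: False
        \<comment> \<open>More than \<open>C * H powr (1 - \<delta>)\<close> hits, multiplied by
          \<open>L = H powr \<delta>\<close>, give the density hypothesis because
          \<open>l \<le> C\<close>.\<close>
        have "l * real H powr (1 - \<delta>) \<le> C * real H powr (1 - \<delta>)"
          using C(6) by (intro mult_right_mono) auto
        then have "L * (l * real H powr (1 - \<delta>)) \<le> L * card E"
          using dense L(1) by (intro mult_left_mono) auto
        moreover have "L * (l * real H powr (1 - \<delta>)) = l * real H"
          using H by (simp add: L_def powr_diff)
        ultimately have dense': "l * real H \<le> L * card E" by simp
        \<comment> \<open>The powers of \<open>L\<close> in the smallness condition cost at most
          \<open>H powr (1/2)\<close> together, which \<open>\<epsilon>\<close> repays because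
          \<open>\<eta> \<ge> 1/2\<close>.\<close>
        have "(l - 1) + l * (l - 1) \<le> l ^ 2"
          by (cases l) (auto simp: power2_eq_square)
        then have "K * (L ^ ((l - 1) + l * (l - 1)) * \<epsilon>) \<le> K * (real H powr (1 / 2) * \<epsilon>)"
          using \<open>K \<ge> 0\<close> \<open>\<epsilon> > 0\<close> by (intro mult_left_mono mult_right_mono Lpow) auto
        also have "\<dots> = K * C1 / C * (real H powr (1 / 2) * real H powr (- \<eta>))"
          by (simp add: \<epsilon>_def)
        also have "\<dots> \<le> K * C1 / C * 1"
        proof (rule mult_left_mono)
          have "real H powr (1 / 2 + - \<eta>) \<le> real H powr 0"
            using H \<open>1 / 2 \<le> \<eta>\<close> by (intro powr_mono) auto
          then show "real H powr (1 / 2) * real H powr (- \<eta>) \<le> 1"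
            unfolding powr_add[symmetric] using H by simp
        qed (use \<open>K * C1 \<ge> 0\<close> C(1) in simp)
        also have "\<dots> < 1 / 2"
          using C(1,5) by (simp add: divide_less_eq)
        finally have "K * (L ^ ((l - 1) + l * (l - 1)) * \<epsilon>) < 1 / 2" .
        then have small: "l * (6 * L) ^ (l - 1) * ((4 * L) ^ (l * (l - 1)) * \<epsilon>) < 1 / 2"
          by (simp add: K_def power_mult_distrib power_add mult_ac)
        have sgn: "(\<forall>t\<ge>real N. D l t < 0) \<or> (\<forall>t\<ge>real N. 0 \<le> D l t)"
          using T1 NC C(2) by (meson less_imp_le order_trans)
        obtain q P where q: "1 \<le> q" "real q \<le> (4 * L) ^ (l * (l - 1))"
          and P: "partition_on {..<H} P" "finite P" "card P \<le> q * 4 ^ l" "\<forall>S\<in>P. arith_prog S q"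
            "\<forall>S\<in>P. \<forall>h\<in>S. \<forall>h'\<in>S. err f D l N h = err f D l N h'"
          using structure_of_err[OF D0 D' \<open>1 < N\<close> \<open>1 \<le> l\<close> sgn close \<open>\<epsilon> > 0\<close> L small dense'[unfolded E_def]]
          by blast
        have "L ^ (l * (l - 1)) \<le> real H powr (1 / 2)"
          by (intro Lpow) (simp add: power2_eq_square)
        also have "\<dots> \<le> real H powr (1 - \<delta>)"
          using H \<delta>(2) by (intro powr_mono) auto
        finally have Lq: "L ^ (l * (l - 1)) \<le> real H powr (1 - \<delta>)" .
        have q': "real q \<le> 4 ^ (l * (l - 1)) * real H powr (1 - \<delta>)"
        proof -
          have "real q \<le> 4 ^ (l * (l - 1)) * L ^ (l * (l - 1))"
            using q(2) by (simp add: power_mult_distrib)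
          also have "\<dots> \<le> 4 ^ (l * (l - 1)) * real H powr (1 - \<delta>)"
            using Lq by (rule mult_left_mono) simp
          finally show ?thesis .
        qed
        moreover have "4 ^ (l * (l - 1)) * real H powr (1 - \<delta>) \<le> C * real H powr (1 - \<delta>)"
          using C(8) by (intro mult_right_mono) auto
        ultimately have qC: "real q \<le> C * real H powr (1 - \<delta>)" by linarith
        have "real (card P) \<le> real q * 4 ^ l"
          using P(3) by (metis of_nat_le_iff of_nat_mult of_nat_numeral of_nat_power)
        also have "\<dots> \<le> 4 ^ (l * (l - 1)) * real H powr (1 - \<delta>) * 4 ^ l"
          using q' by (intro mult_right_mono) auto
        also have "\<dots> = 4 ^ (l * (l - 1)) * 4 ^ l * real H powr (1 - \<delta>)"
          by simp
        also have "\<dots> \<le> C * real H powr (1 - \<delta>)"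
          using C(7) by (intro mult_right_mono) auto
        finally have "real (card P) \<le> C * real H powr (1 - \<delta>)" .
        then show ?thesis using vals P qC by blast
      qed
    qed
  qed (rule C(1))
qed

section \<open>Counting all error functions and conclusion\<close>

text \<open>The encoding count is \<open>exp (O(H powr \<eta>0 * ln H))\<close>, and
  \<open>ln H \<le> H powr s / s\<close> absorbs the logarithm into the slack \<open>s\<close>. The
  polynomial summand is treated in the same way.\<close>

lemma count_bound:
  fixes C s \<eta>0 :: real and n :: nat
  assumes "1 \<le> C" "0 < s" "0 \<le> \<eta>0"
  shows "\<exists>C'>0. \<forall>H\<ge>1. C * real H ^ n + real ((3 * (H + 1) ^ 3 + 1) ^ nat \<lfloor>C * real H powr \<eta>0\<rfloor>)
    \<le> exp (C' * real H powr (\<eta>0 + s))"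
proof -
  \<comment> \<open>These are the coefficients in the exponents bounding the two summands; the extra
    1 in the final constant absorbs the factor 2 from adding them.\<close>
  define a b where "a = ln C + n / s" and "b = C * (25 + 3 / s)"
  have "0 \<le> a" "0 \<le> b"
    using assms by (auto simp: a_def b_def)
  have "C * real H ^ n + real ((3 * (H + 1) ^ 3 + 1) ^ nat \<lfloor>C * real H powr \<eta>0\<rfloor>)
      \<le> exp ((1 + a + b) * real H powr (\<eta>0 + s))" if "1 \<le> H" for H :: nat
  proof -
    have H: "1 \<le> real H" using that by simp
    define X where "X = real H powr (\<eta>0 + s)"
    have one: "1 \<le> real H powr s" "1 \<le> X"
      using H assms by (auto simp: X_def ge_one_powr_ge_zero)
    have sX: "real H powr s \<le> X"
      unfolding X_def using H assms by (intro powr_mono) auto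
    have ln: "ln H \<le> real H powr s / s"
      using H assms by (intro ln_powr_bound) auto
    have lnX: "ln H \<le> X / s"
      using ln divide_right_mono[OF sX, of s] assms by simp
    have "C * real H ^ n = exp (ln C + n * ln H)"
      using H assms by (simp add: exp_add exp_of_nat_mult)
    also have "ln C + n * ln H \<le> ln C * X + n * (X / s)"
      using one assms lnX mult_left_mono[of 1 X "ln C"] by (intro add_mono mult_left_mono) auto
    also have "\<dots> = a * X" by (simp add: a_def algebra_simps)
    finally have 1: "C * real H ^ n \<le> exp (a * X)" by simp
    define M where "M = nat \<lfloor>C * real H powr \<eta>0\<rfloor>"
    have M: "real M \<le> C * real H powr \<eta>0"
      unfolding M_def using assms by (simp add: of_nat_nat)
    \<comment> \<open>The constant 25 below is \<open>3 * 2 ^ 3 + 1\<close>, from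
      \<open>H + 1 \<le> 2 * H\<close>.\<close>
    have "(H + 1) ^ 3 \<le> (2 * H) ^ 3" using that by (intro power_mono) auto
    moreover have "1 \<le> H ^ 3" using that by simp
    ultimately have "3 * (H + 1) ^ 3 + 1 \<le> 25 * H ^ 3" by (simp add: power_mult_distrib)
    then have "real (3 * (H + 1) ^ 3 + 1) \<le> real (25 * H ^ 3)"
      by (simp only: of_nat_le_iff)
    then have le: "real (3 * (H + 1) ^ 3 + 1) \<le> 25 * real H ^ 3" by simp
    have "ln (25::real) \<le> 25" using ln_le_minus_one[of 25] by simp
    have "25 * real H ^ 3 = exp (ln 25 + 3 * ln H)"
      using H exp_of_nat_mult[of 3 "ln (real H)"] by (simp add: exp_add)
    also have "\<dots> \<le> exp ((25 + 3 / s) * real H powr s)"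
    proof -
      have "ln 25 + 3 * ln H \<le> 25 * real H powr s + 3 * (real H powr s / s)"
        using \<open>ln 25 \<le> 25\<close> one(1) ln by linarith
      then show ?thesis by (simp add: algebra_simps)
    qed
    finally have "real (3 * (H + 1) ^ 3 + 1) \<le> exp ((25 + 3 / s) * real H powr s)"
      using le by linarith
    then have "real (3 * (H + 1) ^ 3 + 1) ^ M \<le> exp ((25 + 3 / s) * real H powr s) ^ M"
      by (intro power_mono) auto
    also have "\<dots> = exp (real M * ((25 + 3 / s) * real H powr s))"
      by (simp add: exp_of_nat_mult)
    also have "\<dots> \<le> exp (C * real H powr \<eta>0 * ((25 + 3 / s) * real H powr s))"
      using M assms by (simp add: mult_right_mono)
    also have "\<dots> = exp (b * X)"
      by (simp add: b_def X_def powr_add algebra_simps)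
    finally have 2: "real ((3 * (H + 1) ^ 3 + 1) ^ M) \<le> exp (b * X)" by simp
    have "exp (a * X) \<le> exp ((a + b) * X)" "exp (b * X) \<le> exp ((a + b) * X)"
      using \<open>0 \<le> a\<close> \<open>0 \<le> b\<close> one(2) by (auto intro: mult_right_mono)
    then have "C * real H ^ n + real ((3 * (H + 1) ^ 3 + 1) ^ M) \<le> 2 * exp ((a + b) * X)"
      using 1 2 by linarith
    also have "\<dots> \<le> exp X * exp ((a + b) * X)"
    proof (rule mult_right_mono)
      show "2 \<le> exp X" using exp_ge_add_one_self[of X] one(2) by linarith
    qed simp
    also have "\<dots> = exp ((1 + a + b) * X)"
      by (simp add: algebra_simps flip: exp_add)
    finally show ?thesis by (simp add: M_def X_def)
  qed
  then show ?thesis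
    using \<open>0 \<le> a\<close> \<open>0 \<le> b\<close> by (intro exI[of _ "1 + a + b"]) auto
qed

theorem theorem2p11:
  fixes l :: nat
  shows "\<exists>\<eta>::real. 0 < \<eta> \<and> \<eta> < 1 \<and>
    (\<forall>(k::nat) (f::real \<Rightarrow> real) (D::nat \<Rightarrow> real \<Rightarrow> real).
       k < l \<and> in_hardy f \<and>
       (\<exists>C>0. \<forall>\<^sub>F t in at_top. \<bar>f t\<bar> \<le> C * t ^ k) \<and>
       (\<forall>t\<ge>1. D 0 t = f t) \<and>
       (\<forall>j. \<forall>t\<ge>1. (D j has_real_derivative D (Suc j) t) (at t within {1..}))
     \<longrightarrow>
       (\<exists>C>0. \<forall>H::nat. H \<ge> 1 \<longrightarrow>
          finite {(\<lambda>h. if h < H then err f D l N h else 0) | N::nat. N \<ge> 1} \<and>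
          real (card {(\<lambda>h. if h < H then err f D l N h else 0) | N::nat. N \<ge> 1})
            \<le> exp (C * real H powr \<eta>) \<and>
          (\<forall>N::nat. N \<ge> 1 \<longrightarrow>
             real N \<le> C * real H powr ((real l + \<eta>) / (real l - real k)) \<or>
             real (card {h. h < H \<and> err f D l N h \<noteq> 0}) \<le> C * real H powr \<eta> \<or>
             (\<exists>P. partition_on {..<H} P \<and> finite P \<and>
                  real (card P) \<le> C * real H powr \<eta> \<and>
                  (\<forall>S\<in>P. \<exists>d. arith_prog S d \<and> real d \<le> C * real H powr \<eta>) \<and>
                  (\<forall>S\<in>P. \<forall>h\<in>S. \<forall>h'\<in>S. err f D l N h = err f D l N h')))))"
proof -
  define \<delta> :: real where "\<delta> = 1 / (2 * (real l + 1)\<^sup>2)"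
  \<comment> \<open>Outside (A), the structured bounds hold with the smaller exponent
    \<open>1 - \<delta>\<close>; the remaining \<open>\<delta> / 2\<close> leaves room for the
    logarithm in the count.\<close>
  define \<eta> where "\<eta> = 1 - \<delta> / 2"
  have "1 \<le> (real l + 1)\<^sup>2" by simp
  then have \<delta>: "0 < \<delta>" "\<delta> \<le> 1 / 2"
    unfolding \<delta>_def by (auto simp: divide_simps)
  show ?thesis
  proof (rule exI[of _ \<eta>], intro conjI allI impI)
    show "0 < \<eta>" "\<eta> < 1" using \<delta> by (auto simp: \<eta>_def)
  next
    fix k :: nat and f :: "real \<Rightarrow> real" and D :: "nat \<Rightarrow> real \<Rightarrow> real"
    assume hyps: "k < l \<and> in_hardy f \<and>
       (\<exists>C>0. \<forall>\<^sub>F t in at_top. \<bar>f t\<bar> \<le> C * t ^ k) \<and>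
       (\<forall>t\<ge>1. D 0 t = f t) \<and>
       (\<forall>j. \<forall>t\<ge>1. (D j has_real_derivative D (Suc j) t) (at t within {1..}))"
    let ?A = "\<lambda>C H N. real N \<le> C * real H powr ((real l + \<eta>) / (real l - real k))"
    let ?B = "\<lambda>C \<eta> H N. real (card {h. h < H \<and> err f D l N h \<noteq> 0}) \<le> C * real H powr \<eta>"
    let ?P = "\<lambda>C \<eta> H N P. partition_on {..<H} P \<and> finite P \<and> real (card P) \<le> C * real H powr \<eta> \<and>
        (\<forall>S\<in>P. \<exists>d. arith_prog S d \<and> real d \<le> C * real H powr \<eta>) \<and>
        (\<forall>S\<in>P. \<forall>h\<in>S. \<forall>h'\<in>S. err f D l N h = err f D l N h')"
    obtain C where "1 \<le> C" and C: "\<And>H N. 1 \<le> H \<Longrightarrow> ?A C H N \<or>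
        (\<forall>h<H. err f D l N h \<in> {-1, 0, 1}) \<and> (?B C (1 - \<delta>) H N \<or> (\<exists>P. ?P C (1 - \<delta>) H N P))"
      using err_trichotomy[of k l f D] hyps unfolding \<delta>_def[symmetric] \<eta>_def[symmetric] by blast
    obtain C' where "C' > 0" and C': "\<And>H. 1 \<le> H \<Longrightarrow>
        C * real H ^ (l + 1) + real ((3 * (H + 1) ^ 3 + 1) ^ nat \<lfloor>C * real H powr (1 - \<delta>)\<rfloor>)
          \<le> exp (C' * real H powr (1 - \<delta> + \<delta> / 2))"
      using count_bound[OF \<open>1 \<le> C\<close>, of "\<delta> / 2" "1 - \<delta>" "l + 1"] \<delta> by auto
    define C2 where "C2 = max C C'"
    have C2: "0 < C2" "C \<le> C2" "C' \<le> C2" using \<open>1 \<le> C\<close> by (auto simp: C2_def)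
    show "\<exists>C>0. \<forall>H::nat. H \<ge> 1 \<longrightarrow>
          finite {(\<lambda>h. if h < H then err f D l N h else 0) | N::nat. N \<ge> 1} \<and>
          real (card {(\<lambda>h. if h < H then err f D l N h else 0) | N::nat. N \<ge> 1})
            \<le> exp (C * real H powr \<eta>) \<and>
          (\<forall>N::nat. N \<ge> 1 \<longrightarrow> ?A C H N \<or> ?B C \<eta> H N \<or> (\<exists>P. ?P C \<eta> H N P))"
    proof (intro exI[of _ C2] conjI allI impI)
      fix H N :: nat
      assume "1 \<le> H" "1 \<le> N"
      have "real H powr (1 - \<delta>) \<le> real H powr \<eta>"
        using \<open>1 \<le> H\<close> \<delta> by (intro powr_mono) (auto simp: \<eta>_def)
      then have up: "C * real H powr (1 - \<delta>) \<le> C2 * real H powr \<eta>"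
        using C2 by (intro mult_mono) auto
      have "C * real H powr ((real l + \<eta>) / (real l - real k)) \<le> C2 * real H powr ((real l + \<eta>) / (real l - real k))"
        using C2 by (intro mult_right_mono) auto
      then have "?A C2 H N" if "?A C H N"
        using that by linarith
      moreover have "?B C2 \<eta> H N" if "?B C (1 - \<delta>) H N"
        using that up by linarith
      moreover have "?P C2 \<eta> H N P" if "?P C (1 - \<delta>) H N P" for P
        using that up by (meson order_trans)
      ultimately show "?A C2 H N \<or> ?B C2 \<eta> H N \<or> (\<exists>P. ?P C2 \<eta> H N P)"
        using C[OF \<open>1 \<le> H\<close>, of N] by blast
    next
      fix H :: nat
      assume H: "1 \<le> H"
      define r where "r N = (\<lambda>h. if h < H then err f D l N h else 0)" for N
      define M where "M = nat \<lfloor>C * real H powr (1 - \<delta>)\<rfloor>"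
      \<comment> \<open>This range contains every \<open>N\<close> allowed by (A), because
        \<open>(l + \<eta>) / (l - k) \<le> l + 1\<close>.\<close>
      define \<N> where "\<N> = {1..nat \<lfloor>C * real H ^ (l + 1)\<rfloor>}"
      define \<E> where "\<E> = {e. const_on_few_progressions H M e \<and> (\<forall>h. e h \<in> {-1, 0, 1::int})}"
      have fin\<E>: "finite \<E>" and card\<E>: "card \<E> \<le> (3 * (H + 1) ^ 3 + 1) ^ M"
        unfolding \<E>_def by (rule const_on_few_progressions_finite_card)+
      have toM: "n \<le> M" if "real n \<le> C * real H powr (1 - \<delta>)" for n
        unfolding M_def using that by (simp add: le_nat_floor)
      \<comment> \<open>Under (A) nothing is known about the values, but few \<open>N\<close> occur;
        otherwise the values lie in \<open>{-1, 0, 1}\<close> and either structured alternative puts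
        \<open>r N\<close> into \<open>\<E>\<close>.\<close>
      have "r N \<in> r ` \<N> \<union> \<E>" if "1 \<le> N" for N
      proof (cases "?A C H N")
        case True
        have lk: "1 \<le> real l - real k" using hyps by linarith
        have "(real l + \<eta>) / (real l - real k) \<le> (real l + \<eta>) / 1"
          using lk \<delta> by (intro divide_left_mono) (auto simp: \<eta>_def)
        also have "\<dots> \<le> real (l + 1)" using \<delta> by (simp add: \<eta>_def)
        finally have "real H powr ((real l + \<eta>) / (real l - real k)) \<le> real H powr real (l + 1)"
          using H by (intro powr_mono) auto
        also have "\<dots> = real H ^ (l + 1)"
          using H by (intro powr_realpow) simp
        finally have "C * real H powr ((real l + \<eta>) / (real l - real k)) \<le> C * real H ^ (l + 1)"
          using \<open>1 \<le> C\<close> by (intro mult_left_mono) auto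
        then have "real N \<le> C * real H ^ (l + 1)" using True by linarith
        then have "N \<in> \<N>"
          using that unfolding \<N>_def by (simp add: le_nat_floor)
        then show ?thesis by blast
      next
        case False
        then have vals: "\<forall>h<H. err f D l N h \<in> {-1, 0, 1}"
          and BC: "?B C (1 - \<delta>) H N \<or> (\<exists>P. ?P C (1 - \<delta>) H N P)"
          using C[OF H, of N] by blast+
        have "\<forall>h. r N h \<in> {-1, 0, 1}" using vals by (simp add: r_def)
        moreover have "const_on_few_progressions H M (r N)"
          using BC
        proof
          assume B: "?B C (1 - \<delta>) H N"
          have "{h. r N h \<noteq> 0} = {h. h < H \<and> err f D l N h \<noteq> 0}"
            by (auto simp: r_def)
          then show ?thesis
            using toM[OF B] by (intro const_on_few_progressions_sparse) (auto simp: r_def split: if_splits)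
        next
          assume "\<exists>P. ?P C (1 - \<delta>) H N P"
          then obtain P where P: "?P C (1 - \<delta>) H N P" by blast
          show ?thesis
          proof (rule const_on_few_progressions_partition[of H P M])
            show "card P \<le> M" using P toM by blast
            show "\<exists>d. arith_prog S d" if "S \<in> P" for S using P that by blast
            show "r N h = r N h'" if "S \<in> P" "h \<in> S" "h' \<in> S" for S h h'
            proof -
              have "S \<subseteq> {..<H}" using P that(1) partition_onD1 by blast
              moreover have "err f D l N h = err f D l N h'" using P that by blast
              ultimately show ?thesis using that(2,3) by (auto simp: r_def)
            qed
          qed (use P in \<open>auto simp: r_def\<close>)
        qed
        ultimately have "r N \<in> \<E>" by (simp add: \<E>_def)
        then show ?thesis by blast
      qed
      then have sub: "{r N | N. 1 \<le> N} \<subseteq> r ` \<N> \<union> \<E>" by blast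
      have fin: "finite (r ` \<N> \<union> \<E>)" using fin\<E> by (simp add: \<N>_def)
      show "finite {(\<lambda>h. if h < H then err f D l N h else 0) | N::nat. N \<ge> 1}"
        unfolding r_def[symmetric] using sub fin by (rule finite_subset)
      have "card {r N | N. 1 \<le> N} \<le> card (r ` \<N>) + card \<E>"
        using card_mono[OF fin sub] card_Un_le[of "r ` \<N>" \<E>] by linarith
      also have "card (r ` \<N>) \<le> nat \<lfloor>C * real H ^ (l + 1)\<rfloor>"
        using card_image_le[of \<N> r] by (simp add: \<N>_def)
      finally have "card {r N | N. 1 \<le> N} \<le> nat \<lfloor>C * real H ^ (l + 1)\<rfloor> + (3 * (H + 1) ^ 3 + 1) ^ M"
        using card\<E> by linarith
      then have "real (card {r N | N. 1 \<le> N})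
          \<le> real (nat \<lfloor>C * real H ^ (l + 1)\<rfloor>) + real ((3 * (H + 1) ^ 3 + 1) ^ M)"
        by (simp only: of_nat_add[symmetric] of_nat_le_iff)
      also have "\<dots> \<le> C * real H ^ (l + 1) + real ((3 * (H + 1) ^ 3 + 1) ^ M)"
        using \<open>1 \<le> C\<close> by (intro add_right_mono) (simp add: of_nat_nat)
      also have "\<dots> \<le> exp (C' * real H powr \<eta>)"
        using C'[OF H] by (simp add: M_def \<eta>_def)
      also have "\<dots> \<le> exp (C2 * real H powr \<eta>)"
        using C2(3) by (simp add: mult_right_mono)
      finally show "real (card {(\<lambda>h. if h < H then err f D l N h else 0) | N::nat. N \<ge> 1})
          \<le> exp (C2 * real H powr \<eta>)"
        unfolding r_def[symmetric] .
    qed (rule C2(1))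
  qed
qed

end
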